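(* Let $\mathcal H_S=\mathbb C^2$ with orthonormal (pointer) basis $|0\rangle,|1\rangle$, let $N\ge 1$, and let $\mathcal H_{not},\mathcal H_1,\dots,\mathcal H_N$ be nonzero finite-dimensional complex Hilbert spaces. Let $\varepsilon_0,\varepsilon_1\in\mathbb R$ and, for $i\in\{0,1\}$, let $\hat V^i_{not}$ and $\hat V^i_k$ ($1\le k\le N$) be self-adjoint operators on $\mathcal H_{not}$ and $\mathcal H_k$ respectively. Consider on $\mathcal H_S\otimes\mathcal H_{not}\otimes\bigotimes_k\mathcal H_k$ the pure dephasing Hamiltonian $$\hat H=\sum_{i\in\{0,1\}}\Big(\varepsilon_i|i\rangle\langle i|+|i\rangle\langle i|\otimes\hat V^i_{not}+\sum_{k=1}^N|i\rangle\langle i|\otimes\hat V^i_k\Big)$$ (identity operators on the remaining factors are understood) and the initial state $$\hat{\tilde\sigma}(0)=|\psi_0\rangle\langle\psi_0|\otimes\hat R_{not}(0)\otimes\bigotimes_{k=1}^N\hat\rho^k(0),\qquad |\psi_0\rangle=a_0|0\rangle+a_1|1\rangle,$$ where $|a_0|^2+|a_1|^2=1$ and $\hat R_{not}(0)$, $\hat\rho^k(0)$ are arbitrary density operators. Let $\hat{\tilde\sigma}(t)=e^{-i\hat Ht}\,\hat{\tilde\sigma}(0)\,e^{i\hat Ht}$ and $\hat\rho^k_{ii}(t)=e^{-i\hat V^i_kt}\hat\rho^k(0)e^{i\hat V^i_kt}$. If at time $t$ the strict orthogonality condition $\hat\rho^k_{00}(t)\hat\rho^k_{11}(t)=0$ holds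 for every observed environment $k=1,\dots,N$, then the Negativity of $\hat{\tilde\sigma}(t)$ between the qubit and all of the environment, i.e. with respect to the bipartition $\mathcal H_S\,|\,\mathcal H_{not}\otimes\bigotimes_k\mathcal H_k$, equals $$\mathcal N(\hat{\tilde\sigma}(t))=|a_0a_1|.$$
   Context: Units with $\hbar=1$. The space $\mathcal H_{not}$ describes the unobserved environment, and $\mathcal H_1,\dots,\mathcal H_N$ describe the observed environments. The Negativity $\mathcal N(\hat\tau)$ of a density operator $\hat\tau$ on a bipartite space $\mathcal A\otimes\mathcal B$ is the absolute value of the sum of all negative eigenvalues (counted with multiplicity) of the partial transpose of $\hat\tau$ with respect to one of the two subsystems. *)

theory Defs
  imports "HOL-Analysis.Analysis" "Jordan_Normal_Form.Schur_Decomposition"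
begin

text \<open>
  A \<open>d\<close>-dimensional Hilbert space is represented by its coordinates in a fixed orthonormal basis
  (for the qubit: the pointer basis), so operators are \<open>d \<times> d\<close> complex matrices. On a tensor product
  the row-major product basis is used: index \<open>r\<close> of \<open>A \<otimes> B\<close> stands for the pair
  \<open>(r div dim B, r mod dim B)\<close>.
\<close>

definition kron :: "complex mat \<Rightarrow> complex mat \<Rightarrow> complex mat" (infixr \<open>\<otimes>\<^sub>K\<close> 75) where
  "A \<otimes>\<^sub>K B = mat (dim_row A * dim_row B) (dim_col A * dim_col B)
     (\<lambda>(r, c). A $$ (r div dim_row B, c div dim_col B) * B $$ (r mod dim_row B, c mod dim_col B))"

definition kron_list :: "complex mat list \<Rightarrow> complex mat" where
  "kron_list As = foldr kron As (1\<^sub>m 1)"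

definition kron_upto :: "nat \<Rightarrow> (nat \<Rightarrow> complex mat) \<Rightarrow> complex mat" where
  "kron_upto N A = kron_list (map A [1..<Suc N])"

text \<open>Matrices of non-fixed dimension have no zero of their type, so the dimension of a sum is explicit.\<close>

definition msum :: "nat \<Rightarrow> ('i \<Rightarrow> complex mat) \<Rightarrow> 'i set \<Rightarrow> complex mat" where
  "msum n f I = mat n n (\<lambda>rc. \<Sum>x\<in>I. f x $$ rc)"

definition mat_exp :: "complex mat \<Rightarrow> complex mat" where
  "mat_exp A = mat (dim_row A) (dim_row A) (\<lambda>rc. \<Sum>m. (A ^\<^sub>m m) $$ rc / fact m)"

definition outer :: "complex vec \<Rightarrow> complex vec \<Rightarrow> complex mat" where
  "outer v w = mat (dim_vec v) (dim_vec w) (\<lambda>(r, c). v $ r * cnj (w $ c))"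

definition mat_trace :: "complex mat \<Rightarrow> complex" where
  "mat_trace A = (\<Sum>i<dim_row A. A $$ (i, i))"

definition self_adjoint_op :: "nat \<Rightarrow> complex mat \<Rightarrow> bool" where
  "self_adjoint_op n A \<longleftrightarrow> A \<in> carrier_mat n n \<and> mat_adjoint A = A"

definition density_op :: "nat \<Rightarrow> complex mat \<Rightarrow> bool" where
  "density_op n \<rho> \<longleftrightarrow> self_adjoint_op n \<rho> \<and>
     (\<forall>v\<in>carrier_vec n. 0 \<le> Re ((\<rho> *\<^sub>v v) \<bullet>c v)) \<and> mat_trace \<rho> = 1"

text \<open>Schroedinger evolution \<open>e\<^bsup>-iHt\<^esup> \<rho> e\<^bsup>iHt\<^esup>\<close>.\<close>

definition evolve :: "complex mat \<Rightarrow> real \<Rightarrow> complex mat \<Rightarrow> complex mat" where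
  "evolve H t \<rho> = mat_exp ((- \<i> * of_real t) \<cdot>\<^sub>m H) * \<rho> * mat_exp ((\<i> * of_real t) \<cdot>\<^sub>m H)"

text \<open>Partial transposition of an operator on \<open>\<complex>\<^sup>m \<otimes> \<complex>\<^sup>n\<close> with respect to the first and to the second
  factor.\<close>

definition ptranspose1 :: "nat \<Rightarrow> nat \<Rightarrow> complex mat \<Rightarrow> complex mat" where
  "ptranspose1 m n M = mat (m * n) (m * n)
     (\<lambda>(r, c). M $$ ((c div n) * n + r mod n, (r div n) * n + c mod n))"

definition ptranspose2 :: "nat \<Rightarrow> nat \<Rightarrow> complex mat \<Rightarrow> complex mat" where
  "ptranspose2 m n M = mat (m * n) (m * n)
     (\<lambda>(r, c). M $$ ((r div n) * n + c mod n, (c div n) * n + r mod n))"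

text \<open>The root order in the characteristic polynomial counts multiplicity (for self-adjoint matrices
  this is also the dimension of the eigenspace). The choice of the transposed factor is immaterial,
  see \<open>negativity_alt\<close>.\<close>

definition negativity :: "nat \<Rightarrow> nat \<Rightarrow> complex mat \<Rightarrow> real" where
  "negativity m n \<tau> = (let P = ptranspose1 m n \<tau> in
     \<bar>\<Sum>x\<in>{x::real. x < 0 \<and> eigenvalue P (of_real x)}.
        real (Polynomial.order (of_real x) (char_poly P)) * x\<bar>)"

lemma ptranspose2_eq: "ptranspose2 m n M = transpose_mat (ptranspose1 m n M)"
  by (rule eq_matI) (auto simp: ptranspose1_def ptranspose2_def)

lemma negativity_alt:
  "negativity m n \<tau> = (let P = ptranspose2 m n \<tau> in
     \<bar>\<Sum>x\<in>{x::real. x < 0 \<and> eigenvalue P (of_real x)}.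
        real (Polynomial.order (of_real x) (char_poly P)) * x\<bar>)"
proof -
  have c: "ptranspose1 m n \<tau> \<in> carrier_mat (m * n) (m * n)"
    and c': "ptranspose2 m n \<tau> \<in> carrier_mat (m * n) (m * n)"
    by (auto simp: ptranspose1_def ptranspose2_def)
  have "char_poly (ptranspose2 m n \<tau>) = char_poly (ptranspose1 m n \<tau>)"
    unfolding ptranspose2_eq by (rule char_poly_transpose_mat[OF c])
  then show ?thesis
    unfolding negativity_def Let_def
    by (simp add: eigenvalue_root_char_poly[OF c] eigenvalue_root_char_poly[OF c'])
qed

definition ket :: "nat \<Rightarrow> complex vec" where
  "ket i = unit_vec 2 i"

definition proj :: "nat \<Rightarrow> complex mat" where
  "proj i = outer (ket i) (ket i)"

definition env_dim :: "nat \<Rightarrow> nat \<Rightarrow> (nat \<Rightarrow> nat) \<Rightarrow> nat" where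
  "env_dim N dn d = dn * (\<Prod>k\<in>{1..N}. d k)"

text \<open>Here \<open>dn\<close> and \<open>d k\<close> are the dimensions of the unobserved and of the \<open>k\<close>-th observed environment,
  \<open>Vn i\<close> and \<open>V i k\<close> the operators acting on them; identities on the other factors are explicit.\<close>

definition dephasing_hamiltonian ::
  "nat \<Rightarrow> nat \<Rightarrow> (nat \<Rightarrow> nat) \<Rightarrow> (nat \<Rightarrow> real) \<Rightarrow> (nat \<Rightarrow> complex mat) \<Rightarrow> (nat \<Rightarrow> nat \<Rightarrow> complex mat)
    \<Rightarrow> complex mat" where
  "dephasing_hamiltonian N dn d \<epsilon> Vn V =
     (let D = 2 * env_dim N dn d; idn = 1\<^sub>m dn; ido = kron_upto N (\<lambda>l. 1\<^sub>m (d l)) in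
      msum D (\<lambda>i.
          of_real (\<epsilon> i) \<cdot>\<^sub>m (proj i \<otimes>\<^sub>K idn \<otimes>\<^sub>K ido)
        + proj i \<otimes>\<^sub>K Vn i \<otimes>\<^sub>K ido
        + msum D (\<lambda>k. proj i \<otimes>\<^sub>K idn \<otimes>\<^sub>K kron_upto N (\<lambda>l. if l = k then V i k else 1\<^sub>m (d l))) {1..N})
      {0, 1})"

definition initial_state ::
  "nat \<Rightarrow> complex \<Rightarrow> complex \<Rightarrow> complex mat \<Rightarrow> (nat \<Rightarrow> complex mat) \<Rightarrow> complex mat" where
  "initial_state N a0 a1 R \<rho> =
     (let \<psi> = a0 \<cdot>\<^sub>v ket 0 + a1 \<cdot>\<^sub>v ket 1 in outer \<psi> \<psi> \<otimes>\<^sub>K R \<otimes>\<^sub>K kron_upto N \<rho>)"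

end

theory Submission
  imports Defs
begin

text \<open>
  Write \<open>H\<close> as the block diagonal matrix \<open>diag(W\<^sub>0, W\<^sub>1)\<close>, let \<open>U\<^sub>i = exp(-i t W\<^sub>i)\<close>, and let \<open>G\<close> be the initial
  state of the environment. The partial transpose of the evolved state has the diagonal blocks
  \<open>|a\<^sub>i|\<^sup>2 G\<^sub>i\<close>, where \<open>G\<^sub>i = U\<^sub>i G U\<^sub>i\<^sup>*\<close>, and the off-diagonal blocks \<open>c U\<^sub>1 G U\<^sub>0\<^sup>*\<close> and
  \<open>cnj c U\<^sub>0 G U\<^sub>1\<^sup>*\<close>, where \<open>c = a\<^sub>1 cnj a\<^sub>0\<close>.
  As \<open>U\<^sub>i\<close> factorises over the environments, orthogonality in a single factor gives
  \<open>G\<^sub>0 G\<^sub>1 = 0\<close>, and then the diagonal part times the off-diagonal part vanishes. Hence the nonzero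
  spectrum of the partial transpose is the union of the nonzero spectra of both parts. The diagonal
  part is positive semidefinite; the off-diagonal part has the eigenvalues \<open>\<plusminus>|c| g\<close> for the
  eigenvalues \<open>g\<close> of \<open>G\<close>, which add up to 1.
\<close>

section \<open>Kronecker products\<close>

text \<open>The row-major index range is cut into \<open>m\<close> consecutive blocks of length
  \<open>n\<close>. Products and traces of Kronecker products and the final eigenvalue sum all rest
  on this splitting.\<close>

lemma sum_div_mod:
  fixes f :: "nat \<Rightarrow> nat \<Rightarrow> 'a::comm_monoid_add"
  shows "(\<Sum>r<m * n. f (r div n) (r mod n)) = (\<Sum>i<m. \<Sum>j<n. f i j)"
proof -
  have "(\<Sum>j<n. f i j) = (\<Sum>r\<in>{i * n..<i * n + n}. f (r div n) (r mod n))" for i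
    by (rule sum.reindex_bij_witness[of _ "\<lambda>r. r - i * n" "\<lambda>j. i * n + j"])
      (auto simp: div_nat_eqI mod_nat_eqI mult.commute)
  then show ?thesis
    by (simp add: sum.nat_group)
qed

lemma div_mod_bounds:
  fixes r :: nat
  assumes "r < m * n"
  shows "r div n < m" "r mod n < n"
  using assms by (auto intro: less_mult_imp_div_less simp: mod_less_divisor gr0_conv_Suc)
    (metis mod_less_divisor mult_0_right not_less0 neq0_conv)

lemma kron_carrier [simp, intro]:
  "A \<in> carrier_mat m p \<Longrightarrow> B \<in> carrier_mat n q \<Longrightarrow> A \<otimes>\<^sub>K B \<in> carrier_mat (m * n) (p * q)"
  by (auto simp: kron_def)

lemma dim_kron [simp]:
  "dim_row (A \<otimes>\<^sub>K B) = dim_row A * dim_row B" "dim_col (A \<otimes>\<^sub>K B) = dim_col A * dim_col B"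
  by (auto simp: kron_def)

lemma index_kron:
  assumes "A \<in> carrier_mat m p" "B \<in> carrier_mat n q" "r < m * n" "c < p * q"
  shows "(A \<otimes>\<^sub>K B) $$ (r, c) = A $$ (r div n, c div q) * B $$ (r mod n, c mod q)"
  using assms by (auto simp: kron_def)

lemma index_mult_sum:
  assumes "A \<in> carrier_mat m n" "B \<in> carrier_mat n p" "i < m" "j < p"
  shows "(A * B) $$ (i, j) = (\<Sum>k<n. A $$ (i, k) * B $$ (k, j))"
  using assms by (auto simp: scalar_prod_def lessThan_atLeast0)

lemma kron_mult:
  assumes A: "A \<in> carrier_mat m p" and C: "C \<in> carrier_mat p q"
    and B: "B \<in> carrier_mat n s" and D: "D \<in> carrier_mat s u"
  shows "(A \<otimes>\<^sub>K B) * (C \<otimes>\<^sub>K D) = (A * C) \<otimes>\<^sub>K (B * D)"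
proof (rule eq_matI)
  have AB: "A \<otimes>\<^sub>K B \<in> carrier_mat (m * n) (p * s)" and CD: "C \<otimes>\<^sub>K D \<in> carrier_mat (p * s) (q * u)"
    and AC: "A * C \<in> carrier_mat m q" and BD: "B * D \<in> carrier_mat n u"
    using assms by auto
  fix r c assume "r < dim_row ((A * C) \<otimes>\<^sub>K (B * D))" "c < dim_col ((A * C) \<otimes>\<^sub>K (B * D))"
  then have r: "r < m * n" and c: "c < q * u" using assms by auto
  note b = div_mod_bounds[OF r] div_mod_bounds[OF c]
  have "((A \<otimes>\<^sub>K B) * (C \<otimes>\<^sub>K D)) $$ (r, c)
    = (\<Sum>k<p * s. (A \<otimes>\<^sub>K B) $$ (r, k) * (C \<otimes>\<^sub>K D) $$ (k, c))"
    by (rule index_mult_sum[OF AB CD r c])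
  also have "\<dots> = (\<Sum>k<p * s. (A $$ (r div n, k div s) * C $$ (k div s, c div u))
      * (B $$ (r mod n, k mod s) * D $$ (k mod s, c mod u)))"
    by (rule sum.cong) (auto simp: index_kron[OF A B r] index_kron[OF C D _ c])
  also have "\<dots> = (\<Sum>i<p. \<Sum>j<s. (A $$ (r div n, i) * C $$ (i, c div u))
      * (B $$ (r mod n, j) * D $$ (j, c mod u)))"
    by (rule sum_div_mod)
  also have "\<dots> = (A * C) $$ (r div n, c div u) * (B * D) $$ (r mod n, c mod u)"
    by (simp add: index_mult_sum[OF A C b(1,3)] index_mult_sum[OF B D b(2,4)] sum_product)
  also have "\<dots> = ((A * C) \<otimes>\<^sub>K (B * D)) $$ (r, c)"
    by (rule index_kron[OF AC BD r c, symmetric])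
  finally show "((A \<otimes>\<^sub>K B) * (C \<otimes>\<^sub>K D)) $$ (r, c) = ((A * C) \<otimes>\<^sub>K (B * D)) $$ (r, c)" .
qed (use assms in auto)

lemma div_mod_eq_iff:
  fixes r c n :: nat
  shows "r = c \<longleftrightarrow> r div n = c div n \<and> r mod n = c mod n"
  by (metis div_mult_mod_eq)

lemma kron_one: "1\<^sub>m m \<otimes>\<^sub>K 1\<^sub>m n = 1\<^sub>m (m * n)"
proof (rule eq_matI)
  fix r c assume "r < dim_row (1\<^sub>m (m * n) :: complex mat)" "c < dim_col (1\<^sub>m (m * n) :: complex mat)"
  then have r: "r < m * n" and c: "c < m * n" by auto
  show "(1\<^sub>m m \<otimes>\<^sub>K 1\<^sub>m n) $$ (r, c) = (1\<^sub>m (m * n) :: complex mat) $$ (r, c)"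
    using r c div_mod_bounds[OF r] div_mod_bounds[OF c] div_mod_eq_iff[of r c n]
    by (auto simp: index_kron[where m = m and p = m and n = n and q = n])
qed auto

lemma mat_trace_kron:
  assumes "A \<in> carrier_mat m m" "B \<in> carrier_mat n n"
  shows "mat_trace (A \<otimes>\<^sub>K B) = mat_trace A * mat_trace B"
proof -
  have "mat_trace (A \<otimes>\<^sub>K B) = (\<Sum>r<m * n. A $$ (r div n, r div n) * B $$ (r mod n, r mod n))"
    using assms by (auto simp: mat_trace_def index_kron intro!: sum.cong)
  also have "\<dots> = mat_trace A * mat_trace B"
    using assms by (simp add: sum_div_mod[where f = "\<lambda>i j. A $$ (i, i) * B $$ (j, j)"] mat_trace_def sum_product)
  finally show ?thesis .
qed

text \<open>The row-major order is lexicographic: strictly below the diagonal, the column index is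
  smaller in the first component, or equal there and smaller in the second. Either way one factor is
  an entry below a diagonal.\<close>

lemma upper_triangular_kron:
  assumes A: "A \<in> carrier_mat m m" "upper_triangular A"
    and B: "B \<in> carrier_mat n n" "upper_triangular B"
  shows "upper_triangular (A \<otimes>\<^sub>K B)"
proof (rule upper_triangularI)
  fix c r assume cr: "c < r" "r < dim_row (A \<otimes>\<^sub>K B)"
  then have r: "r < m * n" and c: "c < m * n" using A B by auto
  have "c div n \<le> r div n" using cr by (simp add: div_le_mono)
  moreover have "c div n = r div n \<Longrightarrow> c mod n < r mod n"
    using cr(1) by (metis add_less_cancel_left div_mult_mod_eq)
  ultimately have "c div n < r div n \<or> c mod n < r mod n" by linarith
  then show "(A \<otimes>\<^sub>K B) $$ (r, c) = 0"
    using A B div_mod_bounds[OF r]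
    by (auto simp: index_kron[OF A(1) B(1) r c] dest: upper_triangularD)
qed

lemma similar_mat_wit_kron:
  assumes 1: "similar_mat_wit A B P Q" and 2: "similar_mat_wit A' B' P' Q'"
  shows "similar_mat_wit (A \<otimes>\<^sub>K A') (B \<otimes>\<^sub>K B') (P \<otimes>\<^sub>K P') (Q \<otimes>\<^sub>K Q')"
proof -
  define m n where "m = dim_row A" and "n = dim_row A'"
  note a = similar_mat_witD[OF m_def 1] and b = similar_mat_witD[OF n_def 2]
  note km = kron_mult[of _ m m _ m _ n n _ n]
  show ?thesis
    by (rule similar_mat_witI[where n = "m * n"])
      (use a b in \<open>auto simp: km kron_one\<close>)
qed

section \<open>The matrix exponential\<close>

text \<open>Each further factor \<open>A\<close> sums \<open>n\<close> terms and costs at most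
  \<open>c\<close> per term. Geometric growth is what the comparison with the scalar exponential
  series needs.\<close>

lemma pow_index_bound:
  fixes A :: "complex mat"
  assumes A: "A \<in> carrier_mat n n" and c: "\<And>i j. i < n \<Longrightarrow> j < n \<Longrightarrow> norm (A $$ (i, j)) \<le> c"
    and ij: "i < n" "j < n"
  shows "norm ((A ^\<^sub>m m) $$ (i, j)) \<le> (of_nat n * c) ^ m"
  using ij
proof (induction m arbitrary: j)
  case 0
  then show ?case using A by auto
next
  case (Suc m)
  have c0: "0 \<le> c" using c[OF Suc.prems] norm_ge_zero order_trans by blast
  have "norm ((A ^\<^sub>m Suc m) $$ (i, j)) = norm (\<Sum>k<n. (A ^\<^sub>m m) $$ (i, k) * A $$ (k, j))"
    using index_mult_sum[OF pow_carrier_mat[OF A] A Suc.prems] by simp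
  also have "\<dots> \<le> (\<Sum>k<n. (of_nat n * c) ^ m * c)"
    using Suc c0 by (intro sum_norm_le) (auto simp: norm_mult intro!: mult_mono c)
  also have "\<dots> = (of_nat n * c) ^ Suc m" by simp
  finally show ?case .
qed

lemma mat_exp_summable:
  fixes A :: "complex mat"
  assumes A: "A \<in> carrier_mat n n" and ij: "i < n" "j < n"
  shows "summable (\<lambda>m. norm ((A ^\<^sub>m m) $$ (i, j) / fact m))"
proof -
  define c where "c = Max ((\<lambda>(i, j). norm (A $$ (i, j))) ` ({..<n} \<times> {..<n}))"
  have c: "norm (A $$ (i, j)) \<le> c" if "i < n" "j < n" for i j
    unfolding c_def by (rule Max_ge) (use that in auto)
  show ?thesis
  proof (rule summable_comparison_test')
    show "summable (\<lambda>m. inverse (fact m) * (of_nat n * c) ^ m)"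
      by (rule summable_exp)
    show "norm (norm ((A ^\<^sub>m m) $$ (i, j) / fact m)) \<le> inverse (fact m) * (of_nat n * c) ^ m" for m
      using pow_index_bound[OF A c ij, of m]
      by (simp add: norm_divide norm_fact divide_simps)
  qed
qed

lemma mat_exp_carrier [simp, intro]: "A \<in> carrier_mat n n \<Longrightarrow> mat_exp A \<in> carrier_mat n n"
  by (auto simp: mat_exp_def)

lemma index_mat_exp:
  "A \<in> carrier_mat n n \<Longrightarrow> i < n \<Longrightarrow> j < n \<Longrightarrow>
    mat_exp A $$ (i, j) = (\<Sum>m. (A ^\<^sub>m m) $$ (i, j) / fact m)"
  by (auto simp: mat_exp_def)

text \<open>Pascal's rule for divided powers. The factor \<open>Suc m\<close> is split as
  \<open>p + (Suc m - p)\<close>; each half cancels one step of one factorial, and its boundary term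
  (\<open>p = 0\<close> or \<open>p = Suc m\<close>) vanishes.\<close>

lemma sum_binomial_step:
  fixes G :: "nat \<Rightarrow> nat \<Rightarrow> complex"
  shows "(\<Sum>p\<le>m. (G (Suc p) (m - p) + G p (Suc (m - p))) / (fact p * fact (m - p)))
    = of_nat (Suc m) * (\<Sum>p\<le>Suc m. G p (Suc m - p) / (fact p * fact (Suc m - p)))"
proof -
  have "of_nat (Suc m) * (\<Sum>p\<le>Suc m. G p (Suc m - p) / (fact p * fact (Suc m - p)))
    = (\<Sum>p\<le>Suc m. of_nat p * (G p (Suc m - p) / (fact p * fact (Suc m - p))))
    + (\<Sum>p\<le>Suc m. of_nat (Suc m - p) * (G p (Suc m - p) / (fact p * fact (Suc m - p))))"
    unfolding sum_distrib_left sum.distrib[symmetric]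
    by (intro sum.cong refl) (metis distrib_right of_nat_add le_add_diff_inverse atMost_iff)
  also have "(\<Sum>p\<le>Suc m. of_nat p * (G p (Suc m - p) / (fact p * fact (Suc m - p))))
    = (\<Sum>p\<le>m. G (Suc p) (m - p) / (fact p * fact (m - p)))"
    by (subst sum.atMost_Suc_shift) (auto simp del: of_nat_Suc intro!: sum.cong)
  also have "(\<Sum>p\<le>Suc m. of_nat (Suc m - p) * (G p (Suc m - p) / (fact p * fact (Suc m - p))))
    = (\<Sum>p\<le>m. G p (Suc (m - p)) / (fact p * fact (m - p)))"
    by (subst sum.atMost_Suc) (auto simp: Suc_diff_le simp del: of_nat_Suc intro!: sum.cong)
  finally show ?thesis
    by (simp add: sum.distrib add_divide_distrib)
qed

text \<open>\<open>F p q\<close> stands for \<open>X\<^sup>p Y\<^sup>q\<close>. Left abstract, it can be chosen as \<open>A\<^sup>p \<otimes> B\<^sup>q\<close>.\<close>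

lemma pow_add_binomial:
  fixes X Y :: "complex mat"
  assumes X: "X \<in> carrier_mat n n" and Y: "Y \<in> carrier_mat n n"
    and F: "\<And>p q. F p q \<in> carrier_mat n n" and F0: "F 0 0 = 1\<^sub>m n"
    and FX: "\<And>p q. F p q * X = F (Suc p) q" and FY: "\<And>p q. F p q * Y = F p (Suc q)"
    and ij: "i < n" "j < n"
  shows "((X + Y) ^\<^sub>m m) $$ (i, j) / fact m = (\<Sum>p\<le>m. F p (m - p) $$ (i, j) / (fact p * fact (m - p)))"
  using ij
proof (induction m arbitrary: j)
  case 0
  then show ?case using X Y F0 by auto
next
  case (Suc m)
  have XY: "X + Y \<in> carrier_mat n n" using X Y by auto
  have "((X + Y) ^\<^sub>m Suc m) $$ (i, j) / fact m
      = (\<Sum>k<n. ((X + Y) ^\<^sub>m m) $$ (i, k) / fact m * (X + Y) $$ (k, j))"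
    using index_mult_sum[OF pow_carrier_mat[OF XY] XY Suc.prems]
    by (simp add: sum_divide_distrib)
  also have "\<dots> = (\<Sum>k<n. \<Sum>p\<le>m. F p (m - p) $$ (i, k) / (fact p * fact (m - p)) * (X + Y) $$ (k, j))"
    by (rule sum.cong) (use Suc in \<open>auto simp: sum_distrib_right\<close>)
  also have "\<dots> = (\<Sum>p\<le>m. (\<Sum>k<n. F p (m - p) $$ (i, k) * (X + Y) $$ (k, j)) / (fact p * fact (m - p)))"
    by (subst sum.swap) (simp add: sum_divide_distrib)
  also have "\<dots> = (\<Sum>p\<le>m. (F p (m - p) * (X + Y)) $$ (i, j) / (fact p * fact (m - p)))"
    using index_mult_sum[OF F XY Suc.prems] by simp
  also have "\<dots> = (\<Sum>p\<le>m. (F (Suc p) (m - p) $$ (i, j) + F p (Suc (m - p)) $$ (i, j)) / (fact p * fact (m - p)))"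
  proof (rule sum.cong[OF refl])
    fix p
    have "F p (m - p) * (X + Y) = F (Suc p) (m - p) + F p (Suc (m - p))"
      using mult_add_distrib_mat[OF F X Y] FX FY by simp
    then show "(F p (m - p) * (X + Y)) $$ (i, j) / (fact p * fact (m - p)) =
        (F (Suc p) (m - p) $$ (i, j) + F p (Suc (m - p)) $$ (i, j)) / (fact p * fact (m - p))"
      using Suc.prems F[of p "Suc (m - p)"] by auto
  qed
  also have "\<dots> = of_nat (Suc m) * (\<Sum>p\<le>Suc m. F p (Suc m - p) $$ (i, j) / (fact p * fact (Suc m - p)))"
    by (rule sum_binomial_step)
  finally have "((X + Y) ^\<^sub>m Suc m) $$ (i, j) / fact m / of_nat (Suc m)
      = (\<Sum>p\<le>Suc m. F p (Suc m - p) $$ (i, j) / (fact p * fact (Suc m - p)))"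
    by (simp only:) (rule nonzero_mult_div_cancel_left, rule of_nat_neq_0)
  then show ?case
    by (simp only: fact_Suc divide_divide_eq_left mult.commute[of "fact m"] of_nat_mult of_nat_fact)
qed

text \<open>An entry of \<open>(A ^\<^sub>m p) \<otimes>\<^sub>K (B ^\<^sub>m q)\<close> is a single
  product of two scalars, so the binomial expansion turns every term of the series into a
  convolution. The scalar Cauchy product of absolutely convergent series finishes.\<close>

lemma mat_exp_kron_sum:
  assumes A: "A \<in> carrier_mat m m" and B: "B \<in> carrier_mat n n"
  shows "mat_exp (A \<otimes>\<^sub>K 1\<^sub>m n + 1\<^sub>m m \<otimes>\<^sub>K B) = mat_exp A \<otimes>\<^sub>K mat_exp B"
proof (rule eq_matI)
  let ?X = "A \<otimes>\<^sub>K 1\<^sub>m n" and ?Y = "1\<^sub>m m \<otimes>\<^sub>K B"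
  have X: "?X \<in> carrier_mat (m * n) (m * n)" and Y: "?Y \<in> carrier_mat (m * n) (m * n)"
    using A B by auto
  note Ap = pow_carrier_mat[OF A] and Bq = pow_carrier_mat[OF B]
  fix r c assume "r < dim_row (mat_exp A \<otimes>\<^sub>K mat_exp B)" "c < dim_col (mat_exp A \<otimes>\<^sub>K mat_exp B)"
  then have r: "r < m * n" and c: "c < m * n" using A B by (auto simp: mat_exp_def)
  note b = div_mod_bounds[OF r] div_mod_bounds[OF c]
  let ?a = "\<lambda>k. (A ^\<^sub>m k) $$ (r div n, c div n) / fact k"
    and ?b = "\<lambda>k. (B ^\<^sub>m k) $$ (r mod n, c mod n) / fact k"
  have "((?X + ?Y) ^\<^sub>m k) $$ (r, c) / fact k = (\<Sum>p\<le>k. ?a p * ?b (k - p))" for k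
  proof -
    have "((?X + ?Y) ^\<^sub>m k) $$ (r, c) / fact k
        = (\<Sum>p\<le>k. ((A ^\<^sub>m p) \<otimes>\<^sub>K (B ^\<^sub>m (k - p))) $$ (r, c) / (fact p * fact (k - p)))"
    proof (rule pow_add_binomial[OF X Y _ _ _ _ r c, where F = "\<lambda>p q. (A ^\<^sub>m p) \<otimes>\<^sub>K (B ^\<^sub>m q)"])
      show "(A ^\<^sub>m 0) \<otimes>\<^sub>K (B ^\<^sub>m 0) = 1\<^sub>m (m * n)" using A B by (simp add: kron_one)
      show "((A ^\<^sub>m p) \<otimes>\<^sub>K (B ^\<^sub>m q)) * ?X = (A ^\<^sub>m Suc p) \<otimes>\<^sub>K (B ^\<^sub>m q)" for p q
        using right_mult_one_mat[OF Bq] by (simp add: kron_mult[OF Ap A Bq one_carrier_mat])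
      show "((A ^\<^sub>m p) \<otimes>\<^sub>K (B ^\<^sub>m q)) * ?Y = (A ^\<^sub>m p) \<otimes>\<^sub>K (B ^\<^sub>m Suc q)" for p q
        using right_mult_one_mat[OF Ap] by (simp add: kron_mult[OF Ap one_carrier_mat Bq B])
    qed (use Ap Bq in auto)
    also have "\<dots> = (\<Sum>p\<le>k. ?a p * ?b (k - p))"
      by (simp add: index_kron[OF Ap Bq r c])
    finally show ?thesis .
  qed
  then have "mat_exp (?X + ?Y) $$ (r, c) = (\<Sum>k. \<Sum>p\<le>k. ?a p * ?b (k - p))"
    using index_mat_exp[of "?X + ?Y", OF add_carrier_mat[OF Y] r c] by simp
  also have "\<dots> = suminf ?a * suminf ?b"
    by (rule Cauchy_product[symmetric]) (rule mat_exp_summable[OF A b(1,3)] mat_exp_summable[OF B b(2,4)])+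
  also have "\<dots> = (mat_exp A \<otimes>\<^sub>K mat_exp B) $$ (r, c)"
    using A B b by (simp add: index_kron[where m = m and p = m and n = n and q = n, OF _ _ r c] index_mat_exp)
  finally show "mat_exp (?X + ?Y) $$ (r, c) = (mat_exp A \<otimes>\<^sub>K mat_exp B) $$ (r, c)" .
qed (use A B in \<open>auto simp: mat_exp_def\<close>)

lemma mat_exp_zero: "mat_exp (0\<^sub>m n n) = 1\<^sub>m n"
proof (rule eq_matI)
  fix i j assume "i < dim_row (1\<^sub>m n :: complex mat)" "j < dim_col (1\<^sub>m n :: complex mat)"
  then have ij: "i < n" "j < n" by auto
  have "((0\<^sub>m n n :: complex mat) ^\<^sub>m m) $$ (i, j) / fact m = 0" if "m \<noteq> 0" for m
    using that ij by (cases m) (auto simp: right_mult_zero_mat[OF pow_carrier_mat[OF zero_carrier_mat]])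
  then show "mat_exp (0\<^sub>m n n) $$ (i, j) = (1\<^sub>m n :: complex mat) $$ (i, j)"
    using ij suminf_finite[of "{0}" "\<lambda>m. ((0\<^sub>m n n :: complex mat) ^\<^sub>m m) $$ (i, j) / fact m"]
    by (simp add: index_mat_exp[OF zero_carrier_mat])
qed (auto simp: mat_exp_def)

text \<open>This provides the inverses of exponentials. An entry of an ordinary matrix product is a
  finite sum over \<open>k\<close>, hence one Cauchy product is taken for each
  \<open>k\<close>.\<close>

lemma mat_exp_mult_add_eq_0:
  assumes A: "A \<in> carrier_mat n n" and B: "B \<in> carrier_mat n n"
    and AB: "A + B = 0\<^sub>m n n"
    and comm: "A * B = B * A"
  shows "mat_exp A * mat_exp B = 1\<^sub>m n"
proof (rule eq_matI)
  note Ap = pow_carrier_mat[OF A] and Bq = pow_carrier_mat[OF B]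
  fix i j assume "i < dim_row (1\<^sub>m n :: complex mat)" "j < dim_col (1\<^sub>m n :: complex mat)"
  then have ij: "i < n" "j < n" by auto
  let ?a = "\<lambda>k p. (A ^\<^sub>m p) $$ (i, k) / fact p" and ?b = "\<lambda>k p. (B ^\<^sub>m p) $$ (k, j) / fact p"
  \<comment> \<open>Moving \<open>A\<close> past \<open>B ^\<^sub>m q\<close> makes right
    multiplication by \<open>A\<close> raise the first exponent of
    \<open>A ^\<^sub>m p * B ^\<^sub>m q\<close>, as \<open>pow_add_binomial\<close>
    demands.\<close>
  have comm_pow: "B ^\<^sub>m q * A = A * B ^\<^sub>m q" for q
  proof (induction q)
    case 0
    then show ?case using A B by simp
  next
    case (Suc q)
    have "B ^\<^sub>m Suc q * A = B ^\<^sub>m q * (A * B)"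
      using assoc_mult_mat[OF Bq B A] by (simp add: comm)
    also have "\<dots> = (A * B ^\<^sub>m q) * B"
      using assoc_mult_mat[OF Bq A B, of q] Suc by simp
    also have "\<dots> = A * B ^\<^sub>m Suc q" using assoc_mult_mat[OF A Bq B] by simp
    finally show ?case .
  qed
  have *: "((A + B) ^\<^sub>m m) $$ (i, j) / fact m = (\<Sum>k<n. \<Sum>p\<le>m. ?a k p * ?b k (m - p))" for m
  proof -
    have "((A + B) ^\<^sub>m m) $$ (i, j) / fact m
        = (\<Sum>p\<le>m. (A ^\<^sub>m p * B ^\<^sub>m (m - p)) $$ (i, j) / (fact p * fact (m - p)))"
    proof (rule pow_add_binomial[OF A B _ _ _ _ ij, where F = "\<lambda>p q. A ^\<^sub>m p * B ^\<^sub>m q"])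
      show "(A ^\<^sub>m p * B ^\<^sub>m q) * A = A ^\<^sub>m Suc p * B ^\<^sub>m q" for p q
        using assoc_mult_mat[OF Ap Bq A] assoc_mult_mat[OF Ap A Bq] by (simp add: comm_pow)
      show "(A ^\<^sub>m p * B ^\<^sub>m q) * B = A ^\<^sub>m p * B ^\<^sub>m Suc q" for p q
        using assoc_mult_mat[OF Ap Bq B] by simp
    qed (use A B Ap Bq in auto)
    also have "\<dots> = (\<Sum>p\<le>m. \<Sum>k<n. ?a k p * ?b k (m - p))"
      by (simp add: index_mult_sum[OF Ap Bq ij] sum_divide_distrib)
    finally show ?thesis by (subst (asm) sum.swap)
  qed
  have sums: "(\<lambda>m. \<Sum>p\<le>m. ?a k p * ?b k (m - p)) sums (mat_exp A $$ (i, k) * mat_exp B $$ (k, j))"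
    if "k < n" for k
    unfolding index_mat_exp[OF A ij(1) that] index_mat_exp[OF B that ij(2)]
    by (rule Cauchy_product_sums) (rule mat_exp_summable[OF A ij(1) that] mat_exp_summable[OF B that ij(2)])+
  have "mat_exp (A + B) $$ (i, j) = (\<Sum>m. \<Sum>k<n. \<Sum>p\<le>m. ?a k p * ?b k (m - p))"
    using index_mat_exp[OF add_carrier_mat[OF B] ij] * by simp
  \<comment> \<open>The finite sum over \<open>k\<close> leaves the series, since each of the
    \<open>n\<close> convolution series converges.\<close>
  also have "\<dots> = (\<Sum>k<n. mat_exp A $$ (i, k) * mat_exp B $$ (k, j))"
    by (rule sums_unique[symmetric], rule sums_sum) (use sums in auto)
  also have "\<dots> = (mat_exp A * mat_exp B) $$ (i, j)"
    by (rule index_mult_sum[symmetric]) (use A B ij in auto)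
  finally show "(mat_exp A * mat_exp B) $$ (i, j) = (1\<^sub>m n :: complex mat) $$ (i, j)"
    by (simp add: AB mat_exp_zero)
qed (use A B in \<open>auto simp: mat_exp_def\<close>)

lemma mat_exp_smult_inverse:
  assumes "A \<in> carrier_mat n n"
  shows "mat_exp ((- s) \<cdot>\<^sub>m A) * mat_exp (s \<cdot>\<^sub>m A) = 1\<^sub>m n"
    "mat_exp (s \<cdot>\<^sub>m A) * mat_exp ((- s) \<cdot>\<^sub>m A) = 1\<^sub>m n"
proof -
  have comm: "(- s \<cdot>\<^sub>m A) * (s \<cdot>\<^sub>m A) = (s \<cdot>\<^sub>m A) * (- s \<cdot>\<^sub>m A)"
    using assms
    by (simp add: mult_smult_assoc_mat[where nr = n and n = n and nc = n]
        mult_smult_distrib[where nr = n and n = n and nc = n])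
      (auto intro!: eq_matI)
  have sum: "- s \<cdot>\<^sub>m A + s \<cdot>\<^sub>m A = 0\<^sub>m n n" "s \<cdot>\<^sub>m A + - s \<cdot>\<^sub>m A = 0\<^sub>m n n"
    using assms by (auto intro!: eq_matI)
  show "mat_exp ((- s) \<cdot>\<^sub>m A) * mat_exp (s \<cdot>\<^sub>m A) = 1\<^sub>m n"
    by (rule mat_exp_mult_add_eq_0) (use assms sum comm in auto)
  show "mat_exp (s \<cdot>\<^sub>m A) * mat_exp ((- s) \<cdot>\<^sub>m A) = 1\<^sub>m n"
    by (rule mat_exp_mult_add_eq_0) (use assms sum comm in auto)
qed

abbreviation block_diag :: "nat \<Rightarrow> complex mat \<Rightarrow> complex mat \<Rightarrow> complex mat" where
  "block_diag n A B \<equiv> four_block_mat A (0\<^sub>m n n) (0\<^sub>m n n) B"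

lemma mat_exp_block_diag:
  assumes A: "A \<in> carrier_mat n n" and B: "B \<in> carrier_mat n n"
  shows "mat_exp (block_diag n A B) = block_diag n (mat_exp A) (mat_exp B)"
proof (rule eq_matI)
  have C: "block_diag n A B \<in> carrier_mat (n + n) (n + n)" using A B by auto
  fix i j assume "i < dim_row (block_diag n (mat_exp A) (mat_exp B))" "j < dim_col (block_diag n (mat_exp A) (mat_exp B))"
  then have ij: "i < n + n" "j < n + n" using A B by (auto simp: mat_exp_def)
  have "block_diag n (A ^\<^sub>m m) (B ^\<^sub>m m) $$ (i, j) =
      (if i < n then if j < n then (A ^\<^sub>m m) $$ (i, j) else 0
       else if j < n then 0 else (B ^\<^sub>m m) $$ (i - n, j - n))" for m
    using ij by (auto simp: carrier_matD[OF A] carrier_matD[OF B])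
  then show "mat_exp (block_diag n A B) $$ (i, j) = block_diag n (mat_exp A) (mat_exp B) $$ (i, j)"
    unfolding index_mat_exp[OF C ij] pow_four_block_mat[OF A B]
    using ij A B by (auto simp: index_mat_exp[OF A] index_mat_exp[OF B]
        carrier_matD[OF mat_exp_carrier[OF A]] carrier_matD[OF mat_exp_carrier[OF B]])
qed (use A B in \<open>auto simp: mat_exp_def\<close>)

section \<open>Characteristic polynomials\<close>

text \<open>Orders of nonzero polynomials add under multiplication, and each linear factor
  contributes 1 or 0. Indexing the roots by a set \<open>J\<close> encodes multiplicity as repeated
  values of \<open>f\<close>.\<close>

lemma order_prod_linear:
  fixes f :: "'i \<Rightarrow> real"
  assumes "finite J"
  shows "Polynomial.order (of_real x) (\<Prod>j\<in>J. [:- complex_of_real (f j), 1:]) = card {j \<in> J. f j = x}"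
  using assms
proof (induction J rule: finite_induct)
  case empty
  then show ?case by simp
next
  case (insert j J)
  have "Polynomial.order (of_real x) (\<Prod>j\<in>insert j J. [:- complex_of_real (f j), 1:])
    = Polynomial.order (of_real x) [:- complex_of_real (f j), 1:] + card {j \<in> J. f j = x}"
    using insert by (simp add: order_mult prod_zero_iff del: mult_pCons_left)
  also have "Polynomial.order (of_real x) [:- complex_of_real (f j), 1:] = (if f j = x then 1 else 0)"
    using order_power_n_n[of "complex_of_real x" 1] by (auto intro: order_0I)
  also have "(if f j = x then 1 else 0) + card {j \<in> J. f j = x} = card {i \<in> insert j J. f i = x}"
  proof (cases "f j = x")
    case True
    then have "{i \<in> insert j J. f i = x} = insert j {i \<in> J. f i = x}" by auto
    then show ?thesis using True insert by simp
  next
    case False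
    then have "{i \<in> insert j J. f i = x} = {i \<in> J. f i = x}" by auto
    then show ?thesis using False by simp
  qed
  finally show ?case .
qed

lemma poly_prod_linear_eq_0:
  fixes f :: "'i \<Rightarrow> real"
  assumes "finite J"
  shows "poly (\<Prod>j\<in>J. [:- complex_of_real (f j), 1:]) (of_real x) = 0 \<longleftrightarrow> x \<in> f ` J"
  using assms by (auto simp: poly_prod)

text \<open>This converts the sum in \<open>negativity\<close>, over distinct roots weighted by
  multiplicity, into a sum over root indices. Indices are grouped by their value, and
  \<open>min 0\<close> discards the nonnegative roots.\<close>

lemma sum_negative_roots:
  fixes f :: "'i \<Rightarrow> real"
  assumes J: "finite J" and p: "p = (\<Prod>j\<in>J. [:- complex_of_real (f j), 1:])"
  shows "(\<Sum>x | x < 0 \<and> poly p (of_real x) = 0. real (Polynomial.order (of_real x) p) * x)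
    = (\<Sum>j\<in>J. min 0 (f j))"
proof -
  have S: "{x. x < 0 \<and> poly p (of_real x) = 0} = f ` {j \<in> J. f j < 0}"
    unfolding p using poly_prod_linear_eq_0[OF J, of f] by auto
  have "(\<Sum>j\<in>J. min 0 (f j)) = (\<Sum>j\<in>{j \<in> J. f j < 0}. f j)"
    using J by (subst sum.inter_filter) (auto intro!: sum.cong)
  also have "\<dots> = (\<Sum>x\<in>f ` {j \<in> J. f j < 0}. \<Sum>j\<in>{j \<in> {j \<in> J. f j < 0}. f j = x}. f j)"
    using J by (subst sum.image_gen[where g = f]) auto
  also have "\<dots> = (\<Sum>x\<in>f ` {j \<in> J. f j < 0}. real (card {j \<in> J. f j = x}) * x)"
  proof (rule sum.cong[OF refl])
    fix x assume "x \<in> f ` {j \<in> J. f j < 0}"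
    then have "{j \<in> {j \<in> J. f j < 0}. f j = x} = {j \<in> J. f j = x}" by auto
    then show "(\<Sum>j\<in>{j \<in> {j \<in> J. f j < 0}. f j = x}. f j) = real (card {j \<in> J. f j = x}) * x" by simp
  qed
  finally show ?thesis
    unfolding S by (simp add: p order_prod_linear[OF J])
qed

lemma poly_char_poly:
  assumes A: "(A :: complex mat) \<in> carrier_mat n n"
  shows "poly (char_poly A) x = det (x \<cdot>\<^sub>m 1\<^sub>m n - A)"
proof -
  have "- char_matrix A x = x \<cdot>\<^sub>m 1\<^sub>m n - A"
    using A by (auto simp: char_matrix_def intro!: eq_matI)
  then show ?thesis by (simp add: char_poly_matrix[OF A])
qed

text \<open>If \<open>A B = 0\<close> then \<open>(x - A)(x - B) = x (x - (A + B))\<close>.\<close>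

lemma char_poly_add_orthogonal:
  fixes A B :: "complex mat"
  assumes A: "A \<in> carrier_mat n n" and B: "B \<in> carrier_mat n n" and AB: "A * B = 0\<^sub>m n n"
  shows "[:0, 1:] ^ n * char_poly (A + B) = char_poly A * char_poly B"
\<comment> \<open>Complex polynomials agree once their values do, so only determinants of complex
  matrices at a fixed \<open>x\<close> are involved.\<close>
proof (intro iffD1[OF poly_eq_poly_eq_iff] ext)
  fix x
  let ?I = "x \<cdot>\<^sub>m 1\<^sub>m n :: complex mat"
  have I: "?I \<in> carrier_mat n n" by simp
  have "(?I - A) * (?I - B) = (?I * ?I - A * ?I) - (?I * B - A * B)"
    using A B by (simp add: mult_minus_distrib_mat[OF minus_carrier_mat[OF A] I B]
        minus_mult_distrib_mat[OF I A I] minus_mult_distrib_mat[OF I A B])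
  also have "\<dots> = x \<cdot>\<^sub>m (?I - (A + B))"
    using A B by (auto simp: AB mult_smult_distrib[OF A one_carrier_mat] intro!: eq_matI simp: algebra_simps)
  finally have "(?I - A) * (?I - B) = x \<cdot>\<^sub>m (?I - (A + B))" .
  then have "det (?I - A) * det (?I - B) = det (x \<cdot>\<^sub>m (?I - (A + B)))"
    using det_mult[OF minus_carrier_mat[OF A] minus_carrier_mat[OF B], of ?I ?I] by simp
  also have "\<dots> = x ^ n * det (?I - (A + B))" using A B by simp
  finally show "poly ([:0, 1:] ^ n * char_poly (A + B)) x = poly (char_poly A * char_poly B) x"
    using A B by (simp add: poly_char_poly[where n = n])
qed

text \<open>Encodes that \<open>f\<close> enumerates the eigenvalues of \<open>A\<close>, all real,
  with multiplicity. A triangular form is enough to read off the characteristic polynomial and the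
  trace, and it survives Kronecker products and similarity with an explicit enumeration.\<close>

definition triangularizable :: "nat \<Rightarrow> complex mat \<Rightarrow> (nat \<Rightarrow> real) \<Rightarrow> bool" where
  "triangularizable n A f \<longleftrightarrow> A \<in> carrier_mat n n \<and>
    (\<exists>B P Q. similar_mat_wit A B P Q \<and> upper_triangular B \<and> (\<forall>i<n. B $$ (i, i) = of_real (f i)))"

lemma triangularizable_kron:
  assumes "triangularizable m A f" "triangularizable n B g"
  shows "triangularizable (m * n) (A \<otimes>\<^sub>K B) (\<lambda>r. f (r div n) * g (r mod n))"
proof -
  obtain A' P Q where A: "A \<in> carrier_mat m m" "similar_mat_wit A A' P Q" "upper_triangular A'"
    "\<forall>i<m. A' $$ (i, i) = of_real (f i)"
    using assms(1) unfolding triangularizable_def by blast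
  obtain B' P' Q' where B: "B \<in> carrier_mat n n" "similar_mat_wit B B' P' Q'" "upper_triangular B'"
    "\<forall>i<n. B' $$ (i, i) = of_real (g i)"
    using assms(2) unfolding triangularizable_def by blast
  have A': "A' \<in> carrier_mat m m" and B': "B' \<in> carrier_mat n n"
    using similar_mat_witD2[OF A(1,2)] similar_mat_witD2[OF B(1,2)] by auto
  have "(A' \<otimes>\<^sub>K B') $$ (r, r) = of_real (f (r div n) * g (r mod n))" if "r < m * n" for r
    using div_mod_bounds[OF that] A(4) B(4) by (simp add: index_kron[OF A' B' that that])
  with similar_mat_wit_kron[OF A(2) B(2)] upper_triangular_kron[OF A' A(3) B' B(3)] A(1) B(1)
  show ?thesis unfolding triangularizable_def by blast
qed

lemma triangularizable_similar:
  assumes "triangularizable n A f" "similar_mat_wit X A P Q"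
  shows "triangularizable n X f"
proof -
  have A: "A \<in> carrier_mat n n" using assms(1) unfolding triangularizable_def by blast
  then have X: "X \<in> carrier_mat n n"
    by (rule similar_mat_witD2(5)[OF _ similar_mat_wit_sym[OF assms(2)]])
  obtain B P' Q' where "similar_mat_wit A B P' Q'" "upper_triangular B" "\<forall>i<n. B $$ (i, i) = of_real (f i)"
    using assms(1) unfolding triangularizable_def by blast
  with similar_mat_wit_trans[OF assms(2) this(1)]
  show ?thesis
    unfolding triangularizable_def using X by blast
qed

lemma triangularizable_char_poly:
  assumes "triangularizable n A f"
  shows "char_poly A = (\<Prod>i<n. [:- of_real (f i), 1:])"
proof -
  obtain B P Q where A: "A \<in> carrier_mat n n" and w: "similar_mat_wit A B P Q" and ut: "upper_triangular B"
    and f: "\<forall>i<n. B $$ (i, i) = of_real (f i)"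
    using assms(1) unfolding triangularizable_def by blast
  have B: "B \<in> carrier_mat n n" using similar_mat_witD2[OF A w] by auto
  have "similar_mat A B" using w unfolding similar_mat_def by blast
  then have "char_poly A = char_poly B" by (rule char_poly_similar)
  also have "\<dots> = (\<Prod>a\<leftarrow>diag_mat B. [:- a, 1:])" by (rule char_poly_upper_triangular[OF B ut])
  also have "\<dots> = (\<Prod>i<n. [:- (B $$ (i, i)), 1:])"
    using B prod.distinct_set_conv_list[of "[0..<n]" "\<lambda>i. [:- (B $$ (i, i)), 1:]"]
    by (simp add: diag_mat_def comp_def lessThan_atLeast0)
  also have "\<dots> = (\<Prod>i<n. [:- of_real (f i), 1:])"
    by (rule prod.cong) (use f in auto)
  finally show ?thesis .
qed

lemma mat_trace_mult_comm:
  assumes "A \<in> carrier_mat n n" "B \<in> carrier_mat n n"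
  shows "mat_trace (A * B) = mat_trace (B * A)"
proof -
  have "mat_trace (A * B) = (\<Sum>i<n. \<Sum>k<n. A $$ (i, k) * B $$ (k, i))"
    using assms by (auto simp: mat_trace_def index_mult_sum[where m = n and n = n and p = n] simp del: index_mult_mat(1))
  also have "\<dots> = (\<Sum>k<n. \<Sum>i<n. B $$ (k, i) * A $$ (i, k))"
    by (subst sum.swap) (simp add: mult.commute)
  also have "\<dots> = mat_trace (B * A)"
    using assms by (auto simp: mat_trace_def index_mult_sum[where m = n and n = n and p = n] simp del: index_mult_mat(1))
  finally show ?thesis .
qed

text \<open>With \<open>A = P * B * Q\<close> and \<open>Q * P = 1\<close>, cyclicity of the trace
  leaves the diagonal of \<open>B\<close>.\<close>

lemma triangularizable_trace:
  assumes "triangularizable n A f"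
  shows "mat_trace A = of_real (\<Sum>i<n. f i)"
proof -
  obtain B P Q where A: "A \<in> carrier_mat n n" and w: "similar_mat_wit A B P Q"
    and f: "\<forall>i<n. B $$ (i, i) = of_real (f i)"
    using assms(1) unfolding triangularizable_def by blast
  note w = similar_mat_witD2[OF A w]
  have "mat_trace A = mat_trace ((P * B) * Q)" using w(3) by simp
  also have "\<dots> = mat_trace (Q * (P * B))"
    by (rule mat_trace_mult_comm[of _ n]) (use w in auto)
  also have "Q * (P * B) = B" using w by (simp add: assoc_mult_mat[symmetric, of Q n n P n B n])
  finally show ?thesis using w f by (simp add: mat_trace_def)
qed

section \<open>Adjoints and the spectrum of a density operator\<close>

lemma index_mat_adjoint:
  "A \<in> carrier_mat n n \<Longrightarrow> i < n \<Longrightarrow> j < n \<Longrightarrow> mat_adjoint A $$ (i, j) = cnj (A $$ (j, i))"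
  by (auto simp: mat_adjoint_def mat_of_rows_def)

lemma mat_adjoint_carrier [simp, intro]: "A \<in> carrier_mat n n \<Longrightarrow> mat_adjoint A \<in> carrier_mat n n"
  by (auto simp: mat_adjoint_def mat_of_rows_def)

lemma self_adjoint_opD:
  assumes "self_adjoint_op n A"
  shows "A \<in> carrier_mat n n" "i < n \<Longrightarrow> j < n \<Longrightarrow> cnj (A $$ (i, j)) = A $$ (j, i)"
  using assms index_mat_adjoint[of A n j i] unfolding self_adjoint_op_def by auto

text \<open>At an eigenvector \<open>v\<close> the form
  \<open>(\<rho> *\<^sub>v v) \<bullet>c v\<close> is \<open>e\<close> times the squared norm of
  \<open>v\<close>. Self-adjointness makes it real, positivity makes it nonnegative, and the squared
  norm is positive.\<close>

lemma density_op_eigenvalue: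
  assumes d: "density_op n \<rho>" and e: "eigenvalue \<rho> e"
  shows "e = of_real (Re e)" "0 \<le> Re e"
proof -
  have sa: "self_adjoint_op n \<rho>" using d unfolding density_op_def by blast
  note \<rho> = self_adjoint_opD[OF sa]
  obtain v where v: "v \<in> carrier_vec n" "v \<noteq> 0\<^sub>v n" "\<rho> *\<^sub>v v = e \<cdot>\<^sub>v v"
    using e \<rho>(1) unfolding eigenvalue_def eigenvector_def by auto
  define S where "S = (\<Sum>i<n. (cmod (v $ i))\<^sup>2)"
  obtain i where i: "i < n" "v $ i \<noteq> 0" using v(1,2) by (metis carrier_vecD eq_vecI index_zero_vec)
  have S: "S > 0" unfolding S_def by (rule sum_pos2[of _ i]) (use i in auto)
  have "(\<rho> *\<^sub>v v) \<bullet>c v = e * of_real S"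
    using v(1) unfolding v(3)
    by (simp add: scalar_prod_def S_def lessThan_atLeast0 sum_distrib_left complex_norm_square[unfolded of_real_power] mult.assoc)
  moreover have "(\<rho> *\<^sub>v v) \<bullet>c v = (\<Sum>i<n. \<Sum>j<n. \<rho> $$ (i, j) * v $ j * cnj (v $ i))" (is "_ = ?T")
    using v(1) \<rho>(1) by (simp add: scalar_prod_def lessThan_atLeast0 sum_distrib_right)
  \<comment> \<open>Conjugation exchanges the roles of the two summation indices, by the Hermitian
    symmetry of the entries of \<open>\<rho>\<close>.\<close>
  moreover have "cnj ?T = ?T"
  proof -
    have "cnj ?T = (\<Sum>i<n. \<Sum>j<n. \<rho> $$ (j, i) * cnj (v $ j) * v $ i)"
      by (simp add: \<rho>(2))
    also have "\<dots> = ?T" by (subst sum.swap) (simp add: mult.assoc mult.left_commute mult.commute)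
    finally show ?thesis .
  qed
  moreover have "0 \<le> Re ((\<rho> *\<^sub>v v) \<bullet>c v)" using d v(1) unfolding density_op_def by blast
  ultimately have "cnj (e * of_real S) = e * of_real S" "0 \<le> Re (e * of_real S)" by metis+
  then show "e = of_real (Re e)" "0 \<le> Re e"
    using S by (auto simp: zero_le_mult_iff complex_eq_iff)
qed

text \<open>Schur triangularisation stands in for the spectral theorem: the characteristic
  polynomial splits over the complex numbers, its roots form the diagonal, and each of them is an
  eigenvalue, hence real and nonnegative.\<close>

lemma density_op_triangularizable:
  assumes d: "density_op n \<rho>"
  obtains f where "triangularizable n \<rho> f" "\<And>i. i < n \<Longrightarrow> 0 \<le> f i"
proof -
  have \<rho>: "\<rho> \<in> carrier_mat n n" using d unfolding density_op_def self_adjoint_op_def by blast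
  obtain es where es: "char_poly \<rho> = (\<Prod>e\<leftarrow>es. [:- e, 1:])" "length es = n"
    using char_poly_factorized[OF \<rho>] by blast
  obtain B P Q where "schur_decomposition \<rho> es = (B, P, Q)" by (rule prod_cases3)
  from schur_decomposition[OF \<rho> es(1) this]
  have w: "similar_mat_wit \<rho> B P Q" and ut: "upper_triangular B" and dg: "diag_mat B = es" by auto
  have B: "B \<in> carrier_mat n n" using similar_mat_witD2[OF \<rho> w] by auto
  have ev: "eigenvalue \<rho> (es ! i)" if "i < n" for i
  proof -
    have "es ! i \<in> set es" using that es(2) by simp
    then have "\<exists>p\<in>set (map (\<lambda>e. [:- e, 1:]) es). poly p (es ! i) = 0" by force
    then show ?thesis
      unfolding eigenvalue_root_char_poly[OF \<rho>] es(1) poly_prod_list_zero_iff .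
  qed
  have dg': "B $$ (i, i) = es ! i" if "i < n" for i
    using that B dg by (auto simp: diag_mat_def)
  have "B $$ (i, i) = of_real (Re (es ! i))" if "i < n" for i
    unfolding dg'[OF that] by (rule density_op_eigenvalue(1)[OF d ev[OF that]])
  with \<rho> w ut have "triangularizable n \<rho> (\<lambda>i. Re (es ! i))"
    unfolding triangularizable_def by blast
  then show ?thesis by (rule that) (rule density_op_eigenvalue(2)[OF d ev])
qed

section \<open>Partial transposes of block matrices\<close>

definition mat22 :: "complex \<Rightarrow> complex \<Rightarrow> complex \<Rightarrow> complex \<Rightarrow> complex mat" where
  "mat22 a b c d = mat 2 2 (\<lambda>(i, j). if i = 0 then if j = 0 then a else b else if j = 0 then c else d)"

lemma mat22_carrier [simp]: "mat22 a b c d \<in> carrier_mat 2 2"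
  by (simp add: mat22_def)

lemma kron_mat22:
  assumes B: "B \<in> carrier_mat n n"
  shows "mat22 a b c d \<otimes>\<^sub>K B = four_block_mat (a \<cdot>\<^sub>m B) (b \<cdot>\<^sub>m B) (c \<cdot>\<^sub>m B) (d \<cdot>\<^sub>m B)" (is "_ = ?F")
proof (rule eq_matI)
  fix r s assume "r < dim_row ?F" "s < dim_col ?F"
  then have rs: "r < n + n" "s < n + n" using B by auto
  have dm: "r div n = (if r < n then 0 else 1) \<and> r mod n = (if r < n then r else r - n)"
    if "r < n + n" for r :: nat
    using that by (auto intro: div_nat_eqI simp: mod_if)
  show "(mat22 a b c d \<otimes>\<^sub>K B) $$ (r, s) = ?F $$ (r, s)"
    using rs B dm[OF rs(1)] dm[OF rs(2)]
    by (subst index_kron[OF mat22_carrier B]) (auto simp: mat22_def)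
qed (use B in \<open>auto simp: mat22_def\<close>)

lemma mult_block_diag_left:
  assumes "X \<in> carrier_mat n n" "Y \<in> carrier_mat n n" "A \<in> carrier_mat n n" "B \<in> carrier_mat n n"
    "C \<in> carrier_mat n n" "D \<in> carrier_mat n n"
  shows "block_diag n X Y * four_block_mat A B C D = four_block_mat (X * A) (X * B) (Y * C) (Y * D)"
  using assms by (subst mult_four_block_mat[OF assms(1) zero_carrier_mat zero_carrier_mat assms(2-6)]) auto

lemma mult_block_diag_right:
  assumes "X \<in> carrier_mat n n" "Y \<in> carrier_mat n n" "A \<in> carrier_mat n n" "B \<in> carrier_mat n n"
    "C \<in> carrier_mat n n" "D \<in> carrier_mat n n"
  shows "four_block_mat A B C D * block_diag n X Y = four_block_mat (A * X) (B * Y) (C * X) (D * Y)"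
  using assms by (subst mult_four_block_mat[OF assms(3-6,1) zero_carrier_mat zero_carrier_mat assms(2)]) auto

text \<open>\<open>X'\<close> and \<open>Y'\<close> are independent of \<open>X\<close> and
  \<open>Y\<close>, and the qubit matrix is arbitrary, so one formula serves the evolved state and
  both parts of its partial transpose.\<close>

lemma block_diag_sandwich:
  assumes "X \<in> carrier_mat n n" "Y \<in> carrier_mat n n" "X' \<in> carrier_mat n n" "Y' \<in> carrier_mat n n"
    and G: "G \<in> carrier_mat n n"
  shows "block_diag n X Y * (mat22 a b c d \<otimes>\<^sub>K G) * block_diag n X' Y'
    = four_block_mat (a \<cdot>\<^sub>m (X * G * X')) (b \<cdot>\<^sub>m (X * G * Y')) (c \<cdot>\<^sub>m (Y * G * X')) (d \<cdot>\<^sub>m (Y * G * Y'))"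
  unfolding kron_mat22[OF G] using assms
  by (simp add: mult_block_diag_left mult_block_diag_right
      mult_smult_distrib[where nr = n and n = n and nc = n]
      mult_smult_assoc_mat[where nr = n and n = n and nc = n])

text \<open>Conjugation by an invertible block diagonal matrix preserves the spectrum. This reduces
  both parts of the partial transpose to a qubit matrix tensored with \<open>G\<close>.\<close>

lemma similar_block_diag_sandwich:
  assumes "X \<in> carrier_mat n n" "Y \<in> carrier_mat n n" "X' \<in> carrier_mat n n" "Y' \<in> carrier_mat n n"
    and "X * X' = 1\<^sub>m n" "X' * X = 1\<^sub>m n" "Y * Y' = 1\<^sub>m n" "Y' * Y = 1\<^sub>m n"
    and M: "M \<in> carrier_mat (2 * n) (2 * n)"
  shows "similar_mat_wit (block_diag n X Y * M * block_diag n X' Y') M (block_diag n X Y) (block_diag n X' Y')"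
proof (rule similar_mat_witI)
  show "block_diag n X Y * block_diag n X' Y' = 1\<^sub>m (2 * n)" "block_diag n X' Y' * block_diag n X Y = 1\<^sub>m (2 * n)"
    using assms by (simp_all add: mult_block_diag_left mult_2 four_block_one_mat)
  show c: "block_diag n X Y \<in> carrier_mat (2 * n) (2 * n)" "block_diag n X' Y' \<in> carrier_mat (2 * n) (2 * n)"
    using assms by (auto simp: mult_2)
  show "block_diag n X Y * M * block_diag n X' Y' \<in> carrier_mat (2 * n) (2 * n)"
    using c M by (intro mult_carrier_mat)
qed (use M in auto)

lemma ptranspose1_four_block:
  assumes "A \<in> carrier_mat n n" "B \<in> carrier_mat n n" "C \<in> carrier_mat n n" "D \<in> carrier_mat n n"
  shows "ptranspose1 2 n (four_block_mat A B C D) = four_block_mat A C B D" (is "_ = ?F")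
proof (rule eq_matI)
  fix r s assume "r < dim_row ?F" "s < dim_col ?F"
  then have rs: "r < n + n" "s < n + n" using assms by auto
  have dm: "r div n = (if r < n then 0 else 1) \<and> r mod n = (if r < n then r else r - n)"
    if "r < n + n" for r :: nat
    using that by (auto intro: div_nat_eqI simp: mod_if)
  show "ptranspose1 2 n (four_block_mat A B C D) $$ (r, s) = ?F $$ (r, s)"
    using rs assms dm[OF rs(1)] dm[OF rs(2)] by (auto simp: ptranspose1_def)
qed (use assms in \<open>auto simp: ptranspose1_def\<close>)

section \<open>Spectra of the diagonal and the off-diagonal qubit matrix\<close>

lemma triangularizable_diag22:
  "triangularizable 2 (mat22 (of_real a) 0 0 (of_real b)) (\<lambda>i. if i = 0 then a else b)"
  unfolding triangularizable_def
  by (intro conjI exI[of _ "mat22 (of_real a) 0 0 (of_real b)"] exI[of _ "1\<^sub>m 2"] similar_mat_wit_refl)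
    (auto simp: mat22_def)

lemma triangularizable_offdiag22:
  "triangularizable 2 (mat22 0 c (cnj c) 0) (\<lambda>i. if i = 0 then cmod c else - cmod c)"
proof -
  \<comment> \<open>The phase of \<open>c\<close>. The value 1 at \<open>c = 0\<close> keeps its
    modulus equal to 1, so that \<open>?P\<close> below stays invertible.\<close>
  define u where "u = (if c = 0 then 1 else c / of_real (cmod c))"
  have cu: "c = of_real (cmod c) * u" unfolding u_def by simp
  have "cmod u = 1" unfolding u_def by (simp add: norm_divide)
  then have u: "u * cnj u = 1" using complex_norm_square[of u] by simp
  have cc: "cnj c = of_real (cmod c) * cnj u" by (subst cu) simp
  let ?B = "mat22 (of_real (cmod c)) 0 0 (- of_real (cmod c))"
  \<comment> \<open>The columns \<open>(u, 1)\<close> and \<open>(- u, 1)\<close> of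
    \<open>?P\<close> are eigenvectors for \<open>cmod c\<close> and \<open>- cmod c\<close>;
    \<open>?Q\<close> is its inverse because \<open>u * cnj u = 1\<close>.\<close>
  let ?P = "mat22 u (- u) 1 1" and ?Q = "mat22 (cnj u / 2) (1 / 2) (- cnj u / 2) (1 / 2)"
  have mult: "mat22 a b c d * mat22 a' b' c' d'
      = mat22 (a * a' + b * c') (a * b' + b * d') (c * a' + d * c') (c * b' + d * d')" for a b c d a' b' c' d'
    by (rule eq_matI) (auto simp: mat22_def scalar_prod_def numeral_2_eq_2)
  have one: "1\<^sub>m 2 = mat22 1 0 0 1"
    by (rule eq_matI) (auto simp: mat22_def less_2_cases_iff)
  have "similar_mat_wit (mat22 0 c (cnj c) 0) ?B ?P ?Q"
  proof (rule similar_mat_witI[where n = 2])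
    show "?P * ?Q = 1\<^sub>m 2" "?Q * ?P = 1\<^sub>m 2"
      unfolding mult one using u by (auto simp: mult.commute)
    show "mat22 0 c (cnj c) 0 = ?P * ?B * ?Q"
      unfolding mult by (simp add: cc) (metis cu mult.commute)
  qed simp_all
  then show ?thesis
    unfolding triangularizable_def
    by (intro conjI exI[of _ ?B] exI[of _ ?P] exI[of _ ?Q]) (auto simp: mat22_def)
qed

text \<open>The spectral core, free of exponentials. The dynamics enters only through invertible
  matrices with given inverses, because spectra are carried over by similarity. Of the spectrum of
  \<open>G\<close>, only its nonnegativity and its sum 1 enter the result.\<close>

lemma negativity_orthogonal_blocks:
  assumes carr: "U0 \<in> carrier_mat n n" "U1 \<in> carrier_mat n n" "U0' \<in> carrier_mat n n" "U1' \<in> carrier_mat n n"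
    and inv: "U0 * U0' = 1\<^sub>m n" "U0' * U0 = 1\<^sub>m n" "U1 * U1' = 1\<^sub>m n" "U1' * U1 = 1\<^sub>m n"
    and G: "triangularizable n G g" and g0: "\<And>i. i < n \<Longrightarrow> 0 \<le> g i" and tr: "mat_trace G = 1"
    and orth: "(U0 * G * U0') * (U1 * G * U1') = 0\<^sub>m n n" "(U1 * G * U1') * (U0 * G * U0') = 0\<^sub>m n n"
  shows "negativity 2 n (block_diag n U0 U1
      * (mat22 (a0 * cnj a0) (a0 * cnj a1) (a1 * cnj a0) (a1 * cnj a1) \<otimes>\<^sub>K G) * block_diag n U0' U1')
    = cmod (a0 * a1)"
proof -
  have Gc: "G \<in> carrier_mat n n" using G unfolding triangularizable_def by blast
  define c where "c = a1 * cnj a0"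
  define b0 b1 where "b0 = (cmod a0)\<^sup>2" and "b1 = (cmod a1)\<^sup>2"
  have b: "a0 * cnj a0 = of_real b0" "a1 * cnj a1 = of_real b1" and b0: "0 \<le> b0" "0 \<le> b1"
    unfolding b0_def b1_def by (simp_all add: complex_norm_square[symmetric])
  have cc: "a0 * cnj a1 = cnj c" "a1 * cnj a0 = c" unfolding c_def by simp_all
  let ?Z = "0\<^sub>m n n :: complex mat"
  \<comment> \<open>\<open>D\<close> and \<open>A\<close> are the diagonal and off-diagonal parts of
    the partial transpose. The block with \<open>U1 * G * U0'\<close>, lower left in the state,
    stands in the upper right of \<open>A\<close>, as transposing the qubit swaps the two.\<close>
  define D where "D = four_block_mat (of_real b0 \<cdot>\<^sub>m (U0 * G * U0')) ?Z ?Z (of_real b1 \<cdot>\<^sub>m (U1 * G * U1'))"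
  define A where "A = four_block_mat ?Z (c \<cdot>\<^sub>m (U1 * G * U0')) (cnj c \<cdot>\<^sub>m (U0 * G * U1')) ?Z"
  let ?\<tau> = "block_diag n U0 U1
      * (mat22 (a0 * cnj a0) (a0 * cnj a1) (a1 * cnj a0) (a1 * cnj a1) \<otimes>\<^sub>K G) * block_diag n U0' U1'"
  have z: "0 \<cdot>\<^sub>m (X * G * Y) = ?Z" if "X \<in> carrier_mat n n" "Y \<in> carrier_mat n n" for X Y
    using that Gc by (auto intro!: eq_matI)
  have P: "ptranspose1 2 n ?\<tau> = D + A"
    using carr Gc unfolding block_diag_sandwich[OF carr Gc] b cc D_def A_def
    by (subst ptranspose1_four_block) (auto simp: add_four_block_mat[where ?nr1.0 = n and ?nc1.0 = n and ?nr2.0 = n and ?nc2.0 = n])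
  have DG: "D = block_diag n U0 U1 * (mat22 (of_real b0) 0 0 (of_real b1) \<otimes>\<^sub>K G) * block_diag n U0' U1'"
    unfolding block_diag_sandwich[OF carr Gc] D_def using carr by (simp add: z)
  \<comment> \<open>The branches are exchanged here: with \<open>U1\<close> on top and
    \<open>U0\<close> below, the mixed blocks land in the transposed positions. Thus
    \<open>A\<close> and \<open>D\<close> are conjugates by different block matrices.\<close>
  have AG: "A = block_diag n U1 U0 * (mat22 0 c (cnj c) 0 \<otimes>\<^sub>K G) * block_diag n U1' U0'"
    unfolding block_diag_sandwich[OF carr(2,1,4,3) Gc] A_def using carr by (simp add: z)
  define fD where "fD r = (if r div n = 0 then b0 else b1) * g (r mod n)" for r
  define fA where "fA r = (if r div n = 0 then cmod c else - cmod c) * g (r mod n)" for r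
  have D: "triangularizable (2 * n) D fD"
    using triangularizable_similar[OF triangularizable_kron[OF triangularizable_diag22 G]
        similar_block_diag_sandwich[OF carr inv kron_carrier[OF mat22_carrier Gc]]]
    unfolding DG fD_def .
  have A: "triangularizable (2 * n) A fA"
    using triangularizable_similar[OF triangularizable_kron[OF triangularizable_offdiag22 G]
        similar_block_diag_sandwich[OF carr(2,1,4,3) inv(3,4,1,2) kron_carrier[OF mat22_carrier Gc]]]
    unfolding AG fA_def .
  have Dc: "D \<in> carrier_mat (2 * n) (2 * n)" and Ac: "A \<in> carrier_mat (2 * n) (2 * n)"
    using D A unfolding triangularizable_def by blast+
  \<comment> \<open>Inserting \<open>Y' * Y = 1\<close> gives
    \<open>Y * G * X' = (Y * G * Y') * (Y * X')\<close>, so orthogonality of the conditional states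
    also annihilates the mixed blocks.\<close>
  have prod0: "(X * G * X') * (Y * G * X') = ?Z"
    if "(X * G * X') * (Y * G * Y') = ?Z" "X \<in> carrier_mat n n" "X' \<in> carrier_mat n n"
      "Y \<in> carrier_mat n n" "Y' \<in> carrier_mat n n" "Y' * Y = 1\<^sub>m n" for X X' Y Y'
  proof -
    have "Y * G * X' = Y * G * (Y' * Y) * X'" using that Gc by simp
    also have "\<dots> = (Y * G * Y') * (Y * X')"
      using that(2-5) Gc by (simp add: assoc_mult_mat[of _ n n _ n _ n])
    finally have "(X * G * X') * (Y * G * X') = ((X * G * X') * (Y * G * Y')) * (Y * X')"
      using that(2-5) Gc by (simp add: assoc_mult_mat[of _ n n _ n _ n])
    also have "\<dots> = ?Z" unfolding that(1) using that(2-5) by simp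
    finally show ?thesis .
  qed
  \<comment> \<open>Diagonal times off-diagonal leaves two blocks; \<open>orth(1)\<close> kills one
    of them and \<open>orth(2)\<close> the other.\<close>
  have DA: "D * A = 0\<^sub>m (2 * n) (2 * n)"
    using carr Gc prod0[OF orth(1) carr(1,3,2,4) inv(4)] prod0[OF orth(2) carr(2,4,1,3) inv(2)]
    unfolding D_def A_def
    by (simp add: mult_block_diag_left mult_2
        mult_smult_distrib[where nr = n and n = n and nc = n]
        mult_smult_assoc_mat[where nr = n and n = n and nc = n])
  define p where "p = char_poly (D + A)"
  define q where "q = (\<Prod>r<2 * n. [:- complex_of_real (fA r), 1:])"
  define q' where "q' = (\<Prod>r<2 * n. [:- complex_of_real (fD r), 1:])"
  \<comment> \<open>The power of the monomial affects only the root 0, so at negative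
    \<open>x\<close> the roots of \<open>p\<close> are those of \<open>q' * q\<close>. There
    \<open>q'\<close> has none, since the \<open>fD r\<close> are nonnegative.\<close>
  have pq: "[:0, 1:] ^ (2 * n) * p = q' * q"
    using char_poly_add_orthogonal[OF Dc Ac DA]
    unfolding p_def q_def q'_def triangularizable_char_poly[OF D] triangularizable_char_poly[OF A] .
  have nz: "q \<noteq> 0" "q' \<noteq> 0" unfolding q_def q'_def by (simp_all add: prod_zero_iff)
  then have p0: "p \<noteq> 0" using pq by auto
  have q': "poly q' (of_real x) \<noteq> 0" if "x < 0" for x
  proof -
    have "fD r \<ge> 0" if "r < 2 * n" for r
      using b0 g0[OF div_mod_bounds(2)[OF that]] unfolding fD_def by simp
    then show ?thesis
      using that poly_prod_linear_eq_0[of "{..<2 * n}" fD x] unfolding q'_def by force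
  qed
  have root: "poly p (of_real x) = 0 \<longleftrightarrow> poly q (of_real x) = 0" if "x < 0" for x
    using arg_cong[OF pq, of "\<lambda>p. poly p (of_real x)"] q'[OF that] that by auto
  have ord: "Polynomial.order (of_real x) p = Polynomial.order (of_real x) q" if "x < 0" for x
  proof -
    have "Polynomial.order (of_real x) ([:0, 1:] ^ (2 * n) :: complex poly) = 0"
      using that by (intro order_0I) simp
    then show ?thesis
      using arg_cong[OF pq, of "Polynomial.order (of_real x)"] p0 nz order_0I[OF q'[OF that]]
      by (simp add: order_mult)
  qed
  have ev: "eigenvalue (D + A) k \<longleftrightarrow> poly p k = 0" for k
    unfolding p_def by (rule eigenvalue_root_char_poly[OF add_carrier_mat[OF Ac]])
  have "(\<Sum>x | x < 0 \<and> eigenvalue (D + A) (of_real x). real (Polynomial.order (of_real x) p) * x)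
    = (\<Sum>x | x < 0 \<and> poly q (of_real x) = 0. real (Polynomial.order (of_real x) q) * x)"
    unfolding ev by (rule sum.cong) (auto simp: root ord)
  also have "\<dots> = (\<Sum>r<2 * n. min 0 (fA r))"
    by (rule sum_negative_roots) (auto simp: q_def)
  also have "\<dots> = (\<Sum>i<(2::nat). \<Sum>j<n. min 0 ((if i = 0 then cmod c else - cmod c) * g j))"
    unfolding fA_def by (rule sum_div_mod[where f = "\<lambda>i j. min 0 ((if i = 0 then cmod c else - cmod c) * g j)"])
  \<comment> \<open>The half with \<open>i = 0\<close> has nonnegative eigenvalues and drops out;
    the half with \<open>i = 1\<close> contributes \<open>- (cmod c * g j)\<close> for every
    \<open>j\<close>, possibly zero.\<close>
  also have "\<dots> = (\<Sum>j<n. - (cmod c * g j))"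
    using g0 by (simp add: numeral_2_eq_2 min_absorb1 min_absorb2)
  also have "\<dots> = - cmod c"
  proof -
    \<comment> \<open>The eigenvalues of \<open>G\<close> add up to its trace.\<close>
    have "(\<Sum>j<n. g j) = 1"
      by (rule iffD1[OF of_real_eq_1_iff trans[OF triangularizable_trace[OF G, symmetric] tr]])
    then show ?thesis by (simp add: sum_negf sum_distrib_left[symmetric])
  qed
  finally show ?thesis
    unfolding negativity_def Let_def P p_def[symmetric]
    by (simp add: c_def norm_mult mult.commute)
qed

section \<open>The dephasing evolution\<close>

lemma kron_list_simps [simp]: "kron_list [] = 1\<^sub>m 1" "kron_list (A # As) = A \<otimes>\<^sub>K kron_list As"
  by (simp_all add: kron_list_def)

lemma kron_list_carrier:
  assumes "\<And>k. k \<in> set ks \<Longrightarrow> A k \<in> carrier_mat (d k) (d k)"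
  shows "kron_list (map A ks) \<in> carrier_mat (prod_list (map d ks)) (prod_list (map d ks))"
  using assms by (induction ks) auto

lemma kron_list_one: "kron_list (map (\<lambda>k. 1\<^sub>m (d k)) ks) = 1\<^sub>m (prod_list (map d ks))"
  by (induction ks) (auto simp: kron_one)

lemma kron_list_mult:
  assumes "\<And>k. k \<in> set ks \<Longrightarrow> A k \<in> carrier_mat (d k) (d k)"
    and "\<And>k. k \<in> set ks \<Longrightarrow> B k \<in> carrier_mat (d k) (d k)"
  shows "kron_list (map A ks) * kron_list (map B ks) = kron_list (map (\<lambda>k. A k * B k) ks)"
  using assms
proof (induction ks)
  case (Cons k ks)
  have "kron_list (map A ks) \<in> carrier_mat (prod_list (map d ks)) (prod_list (map d ks))"
    "kron_list (map B ks) \<in> carrier_mat (prod_list (map d ks)) (prod_list (map d ks))"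
    by (rule kron_list_carrier; use Cons.prems in simp)+
  with Cons show ?case by (simp add: kron_mult[where m = "d k" and p = "d k" and q = "d k"])
qed simp

lemma kron_add_left:
  assumes "A \<in> carrier_mat m p" "B \<in> carrier_mat m p" "C \<in> carrier_mat n q"
  shows "(A + B) \<otimes>\<^sub>K C = A \<otimes>\<^sub>K C + B \<otimes>\<^sub>K C"
  using assms div_mod_bounds[of _ m n] div_mod_bounds[of _ p q]
  by (intro eq_matI) (auto simp: kron_def distrib_right)

lemma kron_add_right:
  assumes "A \<in> carrier_mat m p" "B \<in> carrier_mat n q" "C \<in> carrier_mat n q"
  shows "A \<otimes>\<^sub>K (B + C) = A \<otimes>\<^sub>K B + A \<otimes>\<^sub>K C"
  using assms div_mod_bounds[of _ m n] div_mod_bounds[of _ p q]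
  by (intro eq_matI) (auto simp: kron_def distrib_left)

lemma kron_smult_left:
  assumes "A \<in> carrier_mat m p" "B \<in> carrier_mat n q"
  shows "(s \<cdot>\<^sub>m A) \<otimes>\<^sub>K B = s \<cdot>\<^sub>m (A \<otimes>\<^sub>K B)"
  using assms div_mod_bounds[of _ m n] div_mod_bounds[of _ p q]
  by (intro eq_matI) (auto simp: kron_def)

lemma kron_smult_right:
  assumes "A \<in> carrier_mat m p" "B \<in> carrier_mat n q"
  shows "A \<otimes>\<^sub>K (s \<cdot>\<^sub>m B) = s \<cdot>\<^sub>m (A \<otimes>\<^sub>K B)"
  using assms div_mod_bounds[of _ m n] div_mod_bounds[of _ p q]
  by (intro eq_matI) (auto simp: kron_def)

lemma kron_zero_left: "B \<in> carrier_mat n q \<Longrightarrow> 0\<^sub>m m p \<otimes>\<^sub>K B = 0\<^sub>m (m * n) (p * q)"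
  using div_mod_bounds[of _ m n] div_mod_bounds[of _ p q]
  by (intro eq_matI) (auto simp: kron_def)

lemma kron_zero_right: "A \<in> carrier_mat m p \<Longrightarrow> A \<otimes>\<^sub>K 0\<^sub>m n q = 0\<^sub>m (m * n) (p * q)"
  using div_mod_bounds[of _ m n] div_mod_bounds[of _ p q]
  by (intro eq_matI) (auto simp: kron_def)

section \<open>Sums of local operators, their exponentials, and product states\<close>

lemma msum_carrier [simp]: "msum n f I \<in> carrier_mat n n"
  by (simp add: msum_def)

lemma msum_cong: "(\<And>k. k \<in> I \<Longrightarrow> f k = g k) \<Longrightarrow> msum n f I = msum n g I"
  unfolding msum_def by (intro eq_matI) (auto intro!: sum.cong)

lemma msum_empty: "msum n f {} = 0\<^sub>m n n"
  unfolding msum_def by (intro eq_matI) auto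

lemma msum_insert:
  assumes "finite I" "k \<notin> I" "f k \<in> carrier_mat n n"
  shows "msum n f (insert k I) = f k + msum n f I"
  using assms unfolding msum_def by (intro eq_matI) auto

lemma msum_kron_right:
  assumes A: "A \<in> carrier_mat m m" and F: "\<And>k. k \<in> I \<Longrightarrow> F k \<in> carrier_mat n n"
  shows "msum (m * n) (\<lambda>k. A \<otimes>\<^sub>K F k) I = A \<otimes>\<^sub>K msum n F I"
proof (rule eq_matI)
  fix r c assume "r < dim_row (A \<otimes>\<^sub>K msum n F I)" "c < dim_col (A \<otimes>\<^sub>K msum n F I)"
  then have r: "r < m * n" and c: "c < m * n" using A by (auto simp: msum_def)
  show "msum (m * n) (\<lambda>k. A \<otimes>\<^sub>K F k) I $$ (r, c) = (A \<otimes>\<^sub>K msum n F I) $$ (r, c)"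
    unfolding index_kron[OF A msum_carrier r c]
    using r c div_mod_bounds[OF r] div_mod_bounds[OF c]
    by (auto simp: msum_def index_kron[OF A F r c] sum_distrib_left intro!: sum.cong)
qed (use A in \<open>auto simp: msum_def\<close>)

text \<open>Splitting off the head \<open>k\<close>, the sum of local terms is \<open>V k\<close> on
  the first factor plus the remaining sum on the others, so \<open>mat_exp_kron_sum\<close>
  factorises the exponential and the induction hypothesis treats the rest. Distinctness puts each
  \<open>V k\<close> in exactly one slot.\<close>

lemma mat_exp_kron_list:
  assumes "distinct ks" and "\<And>k. k \<in> set ks \<Longrightarrow> V k \<in> carrier_mat (d k) (d k)"
  shows "mat_exp (s \<cdot>\<^sub>m msum (prod_list (map d ks))
      (\<lambda>k. kron_list (map (\<lambda>l. if l = k then V k else 1\<^sub>m (d l)) ks)) (set ks))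
    = kron_list (map (\<lambda>k. mat_exp (s \<cdot>\<^sub>m V k)) ks)"
  using assms
proof (induction ks)
  case Nil
  have "s \<cdot>\<^sub>m 0\<^sub>m 1 1 = 0\<^sub>m 1 1" by (rule eq_matI) auto
  then show ?case by (simp add: msum_empty mat_exp_zero)
next
  case (Cons k ks)
  let ?n = "prod_list (map d ks)"
  let ?F = "\<lambda>ks j. kron_list (map (\<lambda>l. if l = j then V j else 1\<^sub>m (d l)) ks)"
  have k: "k \<notin> set ks" and Vk: "V k \<in> carrier_mat (d k) (d k)" using Cons.prems by auto
  have F: "?F ks j \<in> carrier_mat ?n ?n" if "j \<in> set ks" for j
    by (rule kron_list_carrier) (use Cons.prems in auto)
  \<comment> \<open>In the tail the test \<open>l = k\<close> never succeeds, so the term of the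
    head acts as the identity there.\<close>
  have "map (\<lambda>l. if l = k then V k else 1\<^sub>m (d l)) ks = map (\<lambda>l. 1\<^sub>m (d l)) ks"
    using k by auto
  then have Fk: "?F (k # ks) k = V k \<otimes>\<^sub>K 1\<^sub>m ?n" by (simp only: list.map kron_list_simps kron_list_one if_True refl)
  have Fj: "?F (k # ks) j = 1\<^sub>m (d k) \<otimes>\<^sub>K ?F ks j" if "j \<in> set ks" for j
    using that k by auto
  have "msum (d k * ?n) (?F (k # ks)) (set (k # ks))
      = V k \<otimes>\<^sub>K 1\<^sub>m ?n + msum (d k * ?n) (?F (k # ks)) (set ks)"
    using k Vk msum_insert[of "set ks" k "?F (k # ks)" "d k * ?n"] unfolding Fk by simp
  also have "msum (d k * ?n) (?F (k # ks)) (set ks) = msum (d k * ?n) (\<lambda>j. 1\<^sub>m (d k) \<otimes>\<^sub>K ?F ks j) (set ks)"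
    by (rule msum_cong) (rule Fj)
  also have "\<dots> = 1\<^sub>m (d k) \<otimes>\<^sub>K msum ?n (?F ks) (set ks)"
    by (rule msum_kron_right[OF one_carrier_mat F])
  finally have "s \<cdot>\<^sub>m msum (d k * ?n) (?F (k # ks)) (set (k # ks))
      = (s \<cdot>\<^sub>m V k) \<otimes>\<^sub>K 1\<^sub>m ?n + 1\<^sub>m (d k) \<otimes>\<^sub>K (s \<cdot>\<^sub>m msum ?n (?F ks) (set ks))"
    by (simp add: kron_smult_left[OF Vk one_carrier_mat] kron_smult_right[OF one_carrier_mat msum_carrier]
        add_smult_distrib_left_mat[OF kron_carrier[OF Vk one_carrier_mat] kron_carrier[OF one_carrier_mat msum_carrier]])
  moreover have "mat_exp (s \<cdot>\<^sub>m msum ?n (?F ks) (set ks)) = kron_list (map (\<lambda>k. mat_exp (s \<cdot>\<^sub>m V k)) ks)"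
    using Cons by simp
  ultimately show ?case
    by (simp only: mat_exp_kron_sum[OF smult_carrier_mat[OF Vk] smult_carrier_mat[OF msum_carrier]]
        list.map prod_list.Cons kron_list_simps)
qed

lemma triangularizable_one: "triangularizable 1 (1\<^sub>m 1) (\<lambda>_. 1)"
  unfolding triangularizable_def
  by (intro conjI exI[of _ "1\<^sub>m 1"] similar_mat_wit_refl) auto

text \<open>For product states both spectra and traces multiply, so nonnegativity and trace 1 are
  inherited. They are bundled with the enumeration \<open>f\<close> because all three enter
  \<open>negativity_orthogonal_blocks\<close>.\<close>

lemma triangularizable_kron_list:
  assumes "\<And>k. k \<in> set ks \<Longrightarrow> density_op (d k) (\<rho> k)"
  shows "\<exists>f. triangularizable (prod_list (map d ks)) (kron_list (map \<rho> ks)) f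
    \<and> (\<forall>i<prod_list (map d ks). 0 \<le> f i) \<and> mat_trace (kron_list (map \<rho> ks)) = 1"
  using assms
proof (induction ks)
  case Nil
  have "mat_trace (1\<^sub>m 1) = 1" by (simp add: mat_trace_def)
  then show ?case using triangularizable_one by force
next
  case (Cons k ks)
  let ?n = "prod_list (map d ks)"
  obtain f where f: "triangularizable ?n (kron_list (map \<rho> ks)) f" "\<forall>i<?n. 0 \<le> f i"
    and tr: "mat_trace (kron_list (map \<rho> ks)) = 1" using Cons by auto
  have dk: "density_op (d k) (\<rho> k)" using Cons.prems by simp
  obtain g where g: "triangularizable (d k) (\<rho> k) g" "\<And>i. i < d k \<Longrightarrow> 0 \<le> g i"
    using density_op_triangularizable[OF dk] by blast
  have "mat_trace (\<rho> k \<otimes>\<^sub>K kron_list (map \<rho> ks)) = 1"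
    using dk tr f(1) g(1) unfolding density_op_def triangularizable_def
    by (simp add: mat_trace_kron[of _ "d k" _ ?n])
  moreover have "\<forall>r<d k * ?n. 0 \<le> g (r div ?n) * f (r mod ?n)"
    using f(2) g(2) div_mod_bounds[of _ "d k" ?n] by simp
  ultimately show ?case using triangularizable_kron[OF g(1) f(1)] by auto
qed

section \<open>Adjoints of exponentials and of evolved states\<close>

lemma mat_adjoint_eqI:
  assumes "A \<in> carrier_mat n n" "B \<in> carrier_mat n n"
    and "\<And>i j. i < n \<Longrightarrow> j < n \<Longrightarrow> cnj (A $$ (i, j)) = B $$ (j, i)"
  shows "mat_adjoint A = B"
  using assms carrier_matD[OF mat_adjoint_carrier[OF assms(1)]]
  by (intro eq_matI) (auto simp: index_mat_adjoint)

lemma mat_adjoint_mult: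
  fixes A B :: "complex mat"
  assumes A: "A \<in> carrier_mat n n" and B: "B \<in> carrier_mat n n"
  shows "mat_adjoint (A * B) = mat_adjoint B * mat_adjoint A"
proof (rule mat_adjoint_eqI)
  fix i j assume ij: "i < n" "j < n"
  show "cnj ((A * B) $$ (i, j)) = (mat_adjoint B * mat_adjoint A) $$ (j, i)"
    unfolding index_mult_sum[OF A B ij]
      index_mult_sum[OF mat_adjoint_carrier[OF B] mat_adjoint_carrier[OF A] ij(2,1)]
    using ij by (simp add: index_mat_adjoint[OF A] index_mat_adjoint[OF B] mult.commute)
qed (intro mult_carrier_mat[of _ n n] mat_adjoint_carrier A B)+

lemma mat_adjoint_smult:
  fixes A :: "complex mat"
  assumes "A \<in> carrier_mat n n"
  shows "mat_adjoint (s \<cdot>\<^sub>m A) = cnj s \<cdot>\<^sub>m mat_adjoint A"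
  by (rule mat_adjoint_eqI[of _ n]) (use assms carrier_matD[OF mat_adjoint_carrier[OF assms]] in \<open>auto simp: index_mat_adjoint[OF assms]\<close>)

text \<open>Conjugation is bounded and real-linear, so it passes inside the convergent series of
  each entry; it remains to compare powers.\<close>

lemma mat_adjoint_mat_exp:
  assumes A: "A \<in> carrier_mat n n"
  shows "mat_adjoint (mat_exp A) = mat_exp (mat_adjoint A)"
proof (rule mat_adjoint_eqI)
  \<comment> \<open>The adjoint reverses products, so the next power is first rewritten as
    \<open>A * A ^\<^sub>m m\<close>; its adjoint then ends in \<open>mat_adjoint A\<close>, as the
    recursion of powers requires.\<close>
  have comm: "A ^\<^sub>m m * A = A * A ^\<^sub>m m" for m
  proof (induction m)
    case (Suc m)
    then show ?case using assoc_mult_mat[OF A pow_carrier_mat[OF A] A, of m] by simp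
  qed (use A in simp)
  have pow: "mat_adjoint (A ^\<^sub>m m) = mat_adjoint A ^\<^sub>m m" for m
  proof (induction m)
    case 0
    show ?case
      by (rule mat_adjoint_eqI[of _ n]) (use A carrier_matD[OF mat_adjoint_carrier[OF A]] in auto)
  next
    case (Suc m)
    then show ?case
      using mat_adjoint_mult[OF A pow_carrier_mat[OF A], of m] by (simp add: comm)
  qed
  fix i j assume ij: "i < n" "j < n"
  have "cnj (mat_exp A $$ (i, j)) = (\<Sum>m. cnj ((A ^\<^sub>m m) $$ (i, j) / fact m))"
    unfolding index_mat_exp[OF A ij]
    by (rule bounded_linear.suminf[OF bounded_linear_cnj])
      (rule summable_norm_cancel[OF mat_exp_summable[OF A ij]])
  also have "\<dots> = mat_exp (mat_adjoint A) $$ (j, i)"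
    unfolding index_mat_exp[OF mat_adjoint_carrier[OF A] ij(2,1)] pow[symmetric]
    by (simp add: index_mat_adjoint[OF pow_carrier_mat[OF A] ij(2,1)])
  finally show "cnj (mat_exp A $$ (i, j)) = mat_exp (mat_adjoint A) $$ (j, i)" .
qed (use A in auto)

lemma evolve_carrier:
  assumes "V \<in> carrier_mat n n" "\<rho> \<in> carrier_mat n n"
  shows "evolve V t \<rho> \<in> carrier_mat n n"
  unfolding evolve_def
  by (intro mult_carrier_mat[of _ n n] mat_exp_carrier smult_carrier_mat assms)

text \<open>For self-adjoint \<open>V\<close> the two exponentials are adjoints of each other, so
  taking the adjoint of the conjugated \<open>\<rho>\<close> reproduces it.\<close>

lemma evolve_self_adjoint:
  assumes V: "self_adjoint_op n V" and \<rho>: "self_adjoint_op n \<rho>"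
  shows "mat_adjoint (evolve V t \<rho>) = evolve V t \<rho>"
proof -
  have c: "V \<in> carrier_mat n n" "\<rho> \<in> carrier_mat n n" and a: "mat_adjoint V = V" "mat_adjoint \<rho> = \<rho>"
    using V \<rho> unfolding self_adjoint_op_def by auto
  define U U' where "U = mat_exp ((- \<i> * of_real t) \<cdot>\<^sub>m V)" and "U' = mat_exp ((\<i> * of_real t) \<cdot>\<^sub>m V)"
  have U: "U \<in> carrier_mat n n" "U' \<in> carrier_mat n n" "mat_adjoint U = U'" "mat_adjoint U' = U"
    unfolding U_def U'_def using c by (auto simp: mat_adjoint_mat_exp[of _ n] mat_adjoint_smult a)
  show ?thesis
    unfolding evolve_def U_def[symmetric] U'_def[symmetric]
    using U c by (simp add: mat_adjoint_mult[of _ n] a assoc_mult_mat[of _ n n _ n _ n])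
qed

text \<open>Taking adjoints reverses the product. The orthogonality condition fixes one order,
  whereas both orders enter \<open>negativity_orthogonal_blocks\<close>.\<close>

lemma self_adjoint_mult_eq_0_commute:
  fixes A B :: "complex mat"
  assumes "A \<in> carrier_mat n n" "B \<in> carrier_mat n n" "mat_adjoint A = A" "mat_adjoint B = B"
    and "A * B = 0\<^sub>m n n"
  shows "B * A = 0\<^sub>m n n"
proof -
  have "mat_adjoint (0\<^sub>m n n :: complex mat) = 0\<^sub>m n n" by (rule mat_adjoint_eqI) auto
  then show ?thesis using mat_adjoint_mult[OF assms(1,2)] assms(3-5) by metis
qed

section \<open>Block form of the dephasing Hamiltonian and its evolution\<close>

lemma proj_mat22: "proj 0 = mat22 1 0 0 0" "proj (Suc 0) = mat22 0 0 0 1"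
  by (auto simp: proj_def outer_def ket_def mat22_def intro!: eq_matI)

lemma outer_mat22:
  "outer (a0 \<cdot>\<^sub>v ket 0 + a1 \<cdot>\<^sub>v ket 1) (a0 \<cdot>\<^sub>v ket 0 + a1 \<cdot>\<^sub>v ket 1)
    = mat22 (a0 * cnj a0) (a0 * cnj a1) (a1 * cnj a0) (a1 * cnj a1)"
  by (rule eq_matI) (auto simp: outer_def ket_def mat22_def less_2_cases_iff)

text \<open>Phrased with the list \<open>[1..<Suc N]\<close> throughout, in the exact shape to which
  \<open>mat_exp_kron_list\<close> applies.\<close>

definition observed_hamiltonian :: "nat \<Rightarrow> (nat \<Rightarrow> nat) \<Rightarrow> (nat \<Rightarrow> complex mat) \<Rightarrow> complex mat" where
  "observed_hamiltonian N d V = msum (prod_list (map d [1..<Suc N]))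
     (\<lambda>k. kron_list (map (\<lambda>l. if l = k then V k else 1\<^sub>m (d l)) [1..<Suc N])) (set [1..<Suc N])"

text \<open>The energy \<open>e\<close> is absorbed into the operator on the unobserved environment, so that the
  exponential is a pure Kronecker product without an extra phase.\<close>

definition branch_hamiltonian ::
  "nat \<Rightarrow> nat \<Rightarrow> (nat \<Rightarrow> nat) \<Rightarrow> real \<Rightarrow> complex mat \<Rightarrow> (nat \<Rightarrow> complex mat) \<Rightarrow> complex mat" where
  "branch_hamiltonian N dn d e A V = (of_real e \<cdot>\<^sub>m 1\<^sub>m dn + A) \<otimes>\<^sub>K 1\<^sub>m (prod_list (map d [1..<Suc N]))
     + 1\<^sub>m dn \<otimes>\<^sub>K observed_hamiltonian N d V"

lemma env_dim_prod_list: "env_dim N dn d = dn * prod_list (map d [1..<Suc N])"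
  unfolding env_dim_def using prod.distinct_set_conv_list[of "[1..<Suc N]" d]
  by (simp add: atLeastLessThanSuc_atLeastAtMost del: upt_Suc)

text \<open>All terms of branch \<open>i\<close> share the factor \<open>proj i\<close>, which pulls
  out by bilinearity. The two projectors are diagonal matrix units and place the branch operators in
  the diagonal blocks.\<close>

lemma dephasing_hamiltonian_block_diag:
  assumes Vn: "\<And>i. i \<in> {0, 1} \<Longrightarrow> Vn i \<in> carrier_mat dn dn"
    and V: "\<And>i k. i \<in> {0, 1} \<Longrightarrow> k \<in> {1..N} \<Longrightarrow> V i k \<in> carrier_mat (d k) (d k)"
  shows "dephasing_hamiltonian N dn d \<epsilon> Vn V = block_diag (env_dim N dn d)
    (branch_hamiltonian N dn d (\<epsilon> 0) (Vn 0) (V 0)) (branch_hamiltonian N dn d (\<epsilon> 1) (Vn 1) (V 1))"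
proof -
  let ?ks = "[1..<Suc N]"
  define m where "m = prod_list (map d ?ks)"
  define n where "n = env_dim N dn d"
  have nm: "n = dn * m"
    unfolding n_def m_def by (rule env_dim_prod_list)
  have ks: "set ?ks = {1..N}" by auto
  define S where "S i = observed_hamiltonian N d (V i)" for i
  define W where "W i = branch_hamiltonian N dn d (\<epsilon> i) (Vn i) (V i)" for i
  note W_eq = W_def[unfolded branch_hamiltonian_def, folded S_def m_def]
  have Sc: "S i \<in> carrier_mat m m" for i unfolding S_def observed_hamiltonian_def m_def by simp
  have Wc: "W i \<in> carrier_mat n n" if "i \<in> {0, 1}" for i
    using Vn[OF that] Sc unfolding W_eq nm by auto
  have pc: "proj i \<in> carrier_mat 2 2" for i by (simp add: proj_def outer_def ket_def)
  let ?f = "\<lambda>i. of_real (\<epsilon> i) \<cdot>\<^sub>m (proj i \<otimes>\<^sub>K 1\<^sub>m dn \<otimes>\<^sub>K 1\<^sub>m m) + proj i \<otimes>\<^sub>K Vn i \<otimes>\<^sub>K 1\<^sub>m m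
        + msum (2 * n) (\<lambda>k. proj i \<otimes>\<^sub>K 1\<^sub>m dn \<otimes>\<^sub>K kron_upto N (\<lambda>l. if l = k then V i k else 1\<^sub>m (d l))) {1..N}"
  have f: "?f i = proj i \<otimes>\<^sub>K W i" if i: "i \<in> {0, 1}" for i
  proof -
    have F: "kron_upto N (\<lambda>l. if l = k then V i k else 1\<^sub>m (d l)) \<in> carrier_mat m m" if "k \<in> {1..N}" for k
      unfolding kron_upto_def m_def by (rule kron_list_carrier) (use V[OF i] in auto)
    have "msum n (\<lambda>k. 1\<^sub>m dn \<otimes>\<^sub>K kron_upto N (\<lambda>l. if l = k then V i k else 1\<^sub>m (d l))) {1..N} = 1\<^sub>m dn \<otimes>\<^sub>K S i"
      unfolding nm S_def observed_hamiltonian_def m_def[symmetric] kron_upto_def[symmetric] ks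
      by (rule msum_kron_right[OF one_carrier_mat F])
    then have "msum (2 * n) (\<lambda>k. proj i \<otimes>\<^sub>K 1\<^sub>m dn \<otimes>\<^sub>K kron_upto N (\<lambda>l. if l = k then V i k else 1\<^sub>m (d l))) {1..N}
        = proj i \<otimes>\<^sub>K 1\<^sub>m dn \<otimes>\<^sub>K S i"
      using msum_kron_right[OF pc, of "{1..N}" "\<lambda>k. 1\<^sub>m dn \<otimes>\<^sub>K kron_upto N (\<lambda>l. if l = k then V i k else 1\<^sub>m (d l))" n i]
        kron_carrier[OF one_carrier_mat F] unfolding nm by simp
    moreover have "of_real (\<epsilon> i) \<cdot>\<^sub>m (proj i \<otimes>\<^sub>K 1\<^sub>m dn \<otimes>\<^sub>K 1\<^sub>m m) = proj i \<otimes>\<^sub>K (of_real (\<epsilon> i) \<cdot>\<^sub>m 1\<^sub>m dn) \<otimes>\<^sub>K 1\<^sub>m m"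
      using kron_smult_left[OF one_carrier_mat one_carrier_mat] kron_smult_right[OF pc kron_carrier[OF one_carrier_mat one_carrier_mat]]
      by simp
    moreover have "proj i \<otimes>\<^sub>K W i = proj i \<otimes>\<^sub>K (of_real (\<epsilon> i) \<cdot>\<^sub>m 1\<^sub>m dn) \<otimes>\<^sub>K 1\<^sub>m m
        + proj i \<otimes>\<^sub>K Vn i \<otimes>\<^sub>K 1\<^sub>m m + proj i \<otimes>\<^sub>K 1\<^sub>m dn \<otimes>\<^sub>K S i"
    proof -
      have E: "of_real (\<epsilon> i) \<cdot>\<^sub>m 1\<^sub>m dn \<in> carrier_mat dn dn" by simp
      note c = kron_carrier[OF E one_carrier_mat[of m]] kron_carrier[OF Vn[OF i] one_carrier_mat[of m]]
        kron_carrier[OF one_carrier_mat[of dn] Sc[of i]]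
      show ?thesis
        unfolding W_eq kron_add_left[OF E Vn[OF i] one_carrier_mat]
          kron_add_right[OF pc add_carrier_mat[OF c(2)] c(3)] kron_add_right[OF pc c(1,2)] ..
    qed
    ultimately show ?thesis by simp
  qed
  have "dephasing_hamiltonian N dn d \<epsilon> Vn V = msum (2 * n) ?f {0, 1}"
    unfolding dephasing_hamiltonian_def Let_def n_def[symmetric] kron_upto_def[of N "\<lambda>l. 1\<^sub>m (d l)"] kron_list_one m_def ..
  also have "\<dots> = msum (2 * n) (\<lambda>i. proj i \<otimes>\<^sub>K W i) {0, 1}"
    by (rule msum_cong) (rule f)
  also have "\<dots> = proj 0 \<otimes>\<^sub>K W 0 + proj 1 \<otimes>\<^sub>K W 1"
    using kron_carrier[OF pc Wc] by (simp add: msum_insert msum_empty)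
  also have "\<dots> = block_diag n (W 0) (W 1)"
    using Wc[of 0] Wc[of 1] kron_mat22[OF Wc[of 0]] kron_mat22[OF Wc[of 1]]
    by (auto simp: proj_mat22 intro!: eq_matI)
  finally show ?thesis unfolding n_def W_def .
qed

lemma evolve_block_diag:
  assumes "A \<in> carrier_mat n n" "B \<in> carrier_mat n n"
  shows "evolve (block_diag n A B) t \<rho> =
    block_diag n (mat_exp ((- \<i> * of_real t) \<cdot>\<^sub>m A)) (mat_exp ((- \<i> * of_real t) \<cdot>\<^sub>m B)) * \<rho>
    * block_diag n (mat_exp ((\<i> * of_real t) \<cdot>\<^sub>m A)) (mat_exp ((\<i> * of_real t) \<cdot>\<^sub>m B))"
proof -
  have "s \<cdot>\<^sub>m block_diag n A B = block_diag n (s \<cdot>\<^sub>m A) (s \<cdot>\<^sub>m B)" for s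
    using assms by (intro eq_matI) auto
  then show ?thesis unfolding evolve_def using assms by (simp add: mat_exp_block_diag)
qed

lemma mat_exp_smult_kron_sum:
  assumes A: "A \<in> carrier_mat m m" and B: "B \<in> carrier_mat n n"
  shows "mat_exp (s \<cdot>\<^sub>m (A \<otimes>\<^sub>K 1\<^sub>m n + 1\<^sub>m m \<otimes>\<^sub>K B)) = mat_exp (s \<cdot>\<^sub>m A) \<otimes>\<^sub>K mat_exp (s \<cdot>\<^sub>m B)"
  unfolding mat_exp_kron_sum[OF smult_carrier_mat[OF A] smult_carrier_mat[OF B], symmetric]
    add_smult_distrib_left_mat[OF kron_carrier[OF A one_carrier_mat] kron_carrier[OF one_carrier_mat B]]
    kron_smult_left[OF A one_carrier_mat] kron_smult_right[OF one_carrier_mat B] ..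

theorem mainTheorem4:
  fixes N dn :: nat and d :: "nat \<Rightarrow> nat"
    and \<epsilon> :: "nat \<Rightarrow> real"
    and Vn :: "nat \<Rightarrow> complex mat" and V :: "nat \<Rightarrow> nat \<Rightarrow> complex mat"
    and R :: "complex mat" and \<rho> :: "nat \<Rightarrow> complex mat"
    and a0 a1 :: complex and t :: real
  assumes "N \<ge> 1"
    and "dn > 0"
    and "\<And>k. k \<in> {1..N} \<Longrightarrow> d k > 0"
    and "\<And>i. i \<in> {0, 1} \<Longrightarrow> self_adjoint_op dn (Vn i)"
    and "\<And>i k. i \<in> {0, 1} \<Longrightarrow> k \<in> {1..N} \<Longrightarrow> self_adjoint_op (d k) (V i k)"
    and "density_op dn R"
    and "\<And>k. k \<in> {1..N} \<Longrightarrow> density_op (d k) (\<rho> k)"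
    and "(cmod a0)\<^sup>2 + (cmod a1)\<^sup>2 = 1"
    and "\<And>k. k \<in> {1..N} \<Longrightarrow>
           evolve (V 0 k) t (\<rho> k) * evolve (V 1 k) t (\<rho> k) = 0\<^sub>m (d k) (d k)"
  shows "negativity 2 (env_dim N dn d)
           (evolve (dephasing_hamiltonian N dn d \<epsilon> Vn V) t (initial_state N a0 a1 R \<rho>))
         = cmod (a0 * a1)"
proof -
  let ?ks = "[1..<Suc N]"
  have ks: "set ?ks = {1..N}" by auto
  define m where "m = prod_list (map d ?ks)"
  define n where "n = env_dim N dn d"
  have nm: "n = dn * m"
    unfolding n_def m_def by (rule env_dim_prod_list)
  have Vn: "Vn i \<in> carrier_mat dn dn" if "i \<in> {0, 1}" for i
    using assms(4)[OF that] unfolding self_adjoint_op_def by blast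
  have V: "V i k \<in> carrier_mat (d k) (d k)" if "i \<in> {0, 1}" "k \<in> set ?ks" for i k
    using assms(5)[OF that(1)] that(2) unfolding self_adjoint_op_def ks by blast
  have \<rho>sa: "self_adjoint_op (d k) (\<rho> k)" if "k \<in> set ?ks" for k
    using assms(7) that unfolding density_op_def ks by blast
  then have \<rho>c: "\<rho> k \<in> carrier_mat (d k) (d k)" if "k \<in> set ?ks" for k
    using that unfolding self_adjoint_op_def by blast
  define S where "S i = observed_hamiltonian N d (V i)" for i
  define Y where "Y i = of_real (\<epsilon> i) \<cdot>\<^sub>m 1\<^sub>m dn + Vn i" for i
  define W where "W i = Y i \<otimes>\<^sub>K 1\<^sub>m m + 1\<^sub>m dn \<otimes>\<^sub>K S i" for i
  have Sc: "S i \<in> carrier_mat m m" for i unfolding S_def observed_hamiltonian_def m_def by simp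
  have Yc: "Y i \<in> carrier_mat dn dn" if "i \<in> {0, 1}" for i unfolding Y_def using Vn[OF that] by simp
  have Wc: "W i \<in> carrier_mat n n" if "i \<in> {0, 1}" for i
    unfolding W_def nm using Yc[OF that] Sc by auto
  have H: "dephasing_hamiltonian N dn d \<epsilon> Vn V = block_diag n (W 0) (W 1)"
    unfolding n_def W_def Y_def S_def m_def branch_hamiltonian_def[symmetric]
    by (rule dephasing_hamiltonian_block_diag[OF Vn V[unfolded ks]])
  \<comment> \<open>Every evolution becomes conjugation by exponentials with coefficients
    \<open>- s\<close> and \<open>s\<close>, the form in which \<open>mat_exp_smult_inverse\<close>
    supplies inverses.\<close>
  define s where "s = \<i> * of_real t"
  have s: "- \<i> * of_real t = - s" unfolding s_def by simp
  define K where "K = kron_list (map \<rho> ?ks)"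
  define G where "G = R \<otimes>\<^sub>K K"
  have Rc: "R \<in> carrier_mat dn dn" using assms(6) unfolding density_op_def self_adjoint_op_def by blast
  obtain f where f: "triangularizable m K f" "\<forall>i<m. 0 \<le> f i" "mat_trace K = 1"
    using triangularizable_kron_list[of ?ks d \<rho>] assms(7) unfolding ks m_def K_def by blast
  have Kc: "K \<in> carrier_mat m m" using f unfolding triangularizable_def by blast
  obtain g where g: "triangularizable dn R g" "\<And>i. i < dn \<Longrightarrow> 0 \<le> g i"
    using density_op_triangularizable[OF assms(6)] by blast
  have G: "triangularizable n G (\<lambda>r. g (r div m) * f (r mod m))"
    unfolding nm G_def by (rule triangularizable_kron[OF g(1) f(1)])
  have G0: "0 \<le> g (r div m) * f (r mod m)" if "r < n" for r
    using div_mod_bounds[of r dn m] that g(2) f(2) unfolding nm by simp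
  have trG: "mat_trace G = 1"
    using assms(6) f(3) unfolding G_def density_op_def by (simp add: mat_trace_kron[OF Rc Kc])
  \<comment> \<open>\<open>E i\<close> is the state of the whole environment conditional on the
    pointer state \<open>i\<close>; \<open>X i\<close> will be its unobserved factor.\<close>
  define E where "E i = mat_exp (- s \<cdot>\<^sub>m W i) * G * mat_exp (s \<cdot>\<^sub>m W i)" for i
  define X where "X i = mat_exp (- s \<cdot>\<^sub>m Y i) * R * mat_exp (s \<cdot>\<^sub>m Y i)" for i
  have Xc: "X i \<in> carrier_mat dn dn" if "i \<in> {0, 1}" for i
    unfolding X_def using Yc[OF that] Rc by (intro mult_carrier_mat[of _ dn dn] mat_exp_carrier smult_carrier_mat)
  have ec: "evolve (V i k) t (\<rho> k) \<in> carrier_mat (d k) (d k)" if "i \<in> {0, 1}" "k \<in> set ?ks" for i k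
    by (rule evolve_carrier[OF V[OF that] \<rho>c[OF that(2)]])
  \<comment> \<open>The branch exponential is a pure Kronecker product, so conjugation acts factor
    by factor, and the observed factors are exactly the states in the orthogonality
    hypothesis.\<close>
  have E: "E i = X i \<otimes>\<^sub>K kron_list (map (\<lambda>k. evolve (V i k) t (\<rho> k)) ?ks)" if i: "i \<in> {0, 1}" for i
  proof -
    define L where "L s = kron_list (map (\<lambda>k. mat_exp (s \<cdot>\<^sub>m V i k)) ?ks)" for s
    have Lc: "L s \<in> carrier_mat m m" for s
      unfolding L_def m_def by (rule kron_list_carrier) (use V[OF i] in auto)
    have exp: "mat_exp (s \<cdot>\<^sub>m W i) = mat_exp (s \<cdot>\<^sub>m Y i) \<otimes>\<^sub>K L s" for s
      unfolding W_def mat_exp_smult_kron_sum[OF Yc[OF i] Sc]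
      unfolding S_def observed_hamiltonian_def L_def
      by (subst mat_exp_kron_list) (use V[OF i] in auto)
    have e: "mat_exp (s \<cdot>\<^sub>m Y i) \<in> carrier_mat dn dn" for s using Yc[OF i] by simp
    have "L (- s) * K * L s = kron_list (map (\<lambda>k. evolve (V i k) t (\<rho> k)) ?ks)"
    proof -
      have vc: "mat_exp (r \<cdot>\<^sub>m V i k) \<in> carrier_mat (d k) (d k)" if "k \<in> set ?ks" for k r
        using V[OF i that] by simp
      have LK: "L (- s) * K = kron_list (map (\<lambda>k. mat_exp (- s \<cdot>\<^sub>m V i k) * \<rho> k) ?ks)"
        unfolding L_def K_def by (rule kron_list_mult[OF vc \<rho>c])
      show ?thesis
        unfolding LK unfolding L_def evolve_def s s_def[symmetric]
        by (rule kron_list_mult[OF mult_carrier_mat[OF vc \<rho>c] vc])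
    qed
    then show ?thesis
      unfolding E_def exp G_def X_def kron_mult[OF e Rc Lc Kc]
        kron_mult[OF mult_carrier_mat[OF e Rc] e mult_carrier_mat[OF Lc Kc] Lc] by simp
  qed
  \<comment> \<open>Kept general in \<open>i\<close> and \<open>j\<close> because both
    \<open>E 0 * E 1\<close> and \<open>E 1 * E 0\<close> must vanish.\<close>
  have orth: "E i * E j = 0\<^sub>m n n"
    if ij: "i \<in> {0, 1}" "j \<in> {0, 1}"
      and z: "evolve (V i 1) t (\<rho> 1) * evolve (V j 1) t (\<rho> 1) = 0\<^sub>m (d 1) (d 1)" for i j
  proof -
    \<comment> \<open>Since \<open>N \<ge> 1\<close>, the first observed environment is the head of
      the list; a zero head makes the whole Kronecker product vanish.\<close>
    have cons: "?ks = 1 # [Suc 1..<Suc N]" using assms(1) by (simp add: upt_conv_Cons del: upt_Suc)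
    let ?e = "\<lambda>i k. evolve (V i k) t (\<rho> k)"
    have lc: "kron_list (map (?e i) ?ks) \<in> carrier_mat m m" if "i \<in> {0, 1}" for i
      unfolding m_def by (rule kron_list_carrier) (rule ec[OF that])
    have "kron_list (map (\<lambda>k. ?e i k * ?e j k) [Suc 1..<Suc N])
        \<in> carrier_mat (prod_list (map d [Suc 1..<Suc N])) (prod_list (map d [Suc 1..<Suc N]))"
      by (rule kron_list_carrier, rule mult_carrier_mat[OF ec[OF ij(1)] ec[OF ij(2)]]) auto
    then have "kron_list (map (\<lambda>k. ?e i k * ?e j k) ?ks) = 0\<^sub>m m m"
      unfolding m_def cons list.map kron_list_simps z prod_list.Cons by (rule kron_zero_left)
    moreover have "kron_list (map (?e i) ?ks) * kron_list (map (?e j) ?ks) = kron_list (map (\<lambda>k. ?e i k * ?e j k) ?ks)"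
      by (rule kron_list_mult[OF ec[OF ij(1)] ec[OF ij(2)]])
    ultimately have "kron_list (map (?e i) ?ks) * kron_list (map (?e j) ?ks) = 0\<^sub>m m m" by (rule trans[rotated])
    then show ?thesis
      unfolding E[OF ij(1)] E[OF ij(2)] nm kron_mult[OF Xc[OF ij(1)] Xc[OF ij(2)] lc[OF ij(1)] lc[OF ij(2)]]
      by (simp add: kron_zero_right[OF mult_carrier_mat[OF Xc[OF ij(1)] Xc[OF ij(2)]]])
  qed
  have one: "1 \<in> set ?ks" "1 \<in> {1..N}" using assms(1) by auto
  have z: "evolve (V 0 1) t (\<rho> 1) * evolve (V 1 1) t (\<rho> 1) = 0\<^sub>m (d 1) (d 1)"
    by (rule assms(9)[OF one(2)])
  have z': "evolve (V 1 1) t (\<rho> 1) * evolve (V 0 1) t (\<rho> 1) = 0\<^sub>m (d 1) (d 1)"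
    by (rule self_adjoint_mult_eq_0_commute[OF ec[OF _ one(1)] ec[OF _ one(1)]
        evolve_self_adjoint[OF assms(5)[OF _ one(2)] \<rho>sa[OF one(1)]]
        evolve_self_adjoint[OF assms(5)[OF _ one(2)] \<rho>sa[OF one(1)]] z]) auto
  have init: "initial_state N a0 a1 R \<rho>
      = mat22 (a0 * cnj a0) (a0 * cnj a1) (a1 * cnj a0) (a1 * cnj a1) \<otimes>\<^sub>K G"
    unfolding initial_state_def Let_def outer_mat22 G_def K_def kron_upto_def ..
  have U: "mat_exp (r \<cdot>\<^sub>m W i) \<in> carrier_mat n n" if "i \<in> {0, 1}" for r i
    using Wc[OF that] by simp
  have W01: "W 0 \<in> carrier_mat n n" "W 1 \<in> carrier_mat n n" using Wc by auto
  show ?thesis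
    unfolding n_def[symmetric] H evolve_block_diag[OF W01] init s s_def[symmetric]
    by (rule negativity_orthogonal_blocks[OF _ _ _ _ mat_exp_smult_inverse[OF W01(1)] mat_exp_smult_inverse[OF W01(2)]
          G G0 trG orth[OF _ _ z, unfolded E_def] orth[OF _ _ z', unfolded E_def]])
      (auto simp: U)
qed

end
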